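(* Let $n\ge2$, let $D\subset\mathbf R^n$ be a bounded domain (not assumed to contain $0$), and suppose that a measurable real-valued function $V$ satisfies one of the following on $D$: (i) $|V(x)|\le\left(\frac{n-2}{2}\right)^2|x|^{-2}$; or (ii) $D$ is convex with piecewise-smooth boundary, and $|V(x)|\le\frac14\,\mathrm{dist}(x)^{-2}$, where $\mathrm{dist}(x)=\inf\{|x-y|:y\in\partial D\}$. Then the equation $-\Delta u=Vu$ has no nontrivial distributional solutions in $W^{1,2}_0(D)$.
   Context: $W^{1,2}_0(D)$ is the closure of $C_0^\infty(D)$ with respect to $\|\nabla u\|_2$. Distributional solution means $\int_D\nabla u\cdot\nabla\psi\,dx=\int_DVu\psi\,dx$ for all $\psi\in C_0^\infty(D)$; nontrivial means not a.e. zero. Solutions may be complex-valued. *)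

theory Defs
  imports "HOL-Analysis.Analysis"
begin

definition domain :: "(real^'n) set \<Rightarrow> bool"
  where "domain D \<longleftrightarrow> open D \<and> connected D \<and> D \<noteq> {}"

definition partial_deriv :: "'n \<Rightarrow> (real^'n \<Rightarrow> 'b::real_normed_vector) \<Rightarrow> real^'n \<Rightarrow> 'b"
  where "partial_deriv i f x = frechet_derivative f (at x) (axis i 1)"

text \<open>Used only for open \<^term>\<open>U\<close>, where this is the usual class $C^k$.\<close>

primrec Ck_on :: "nat \<Rightarrow> (real^'n) set \<Rightarrow> (real^'n \<Rightarrow> 'b::real_normed_vector) \<Rightarrow> bool"
  where
    "Ck_on 0 U f \<longleftrightarrow> continuous_on U f"
  | "Ck_on (Suc k) U f \<longleftrightarrow>
       (\<forall>x\<in>U. f differentiable (at x)) \<and> (\<forall>i. Ck_on k U (partial_deriv i f))"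

definition smooth_on :: "(real^'n) set \<Rightarrow> (real^'n \<Rightarrow> 'b::real_normed_vector) \<Rightarrow> bool"
  where "smooth_on U f \<longleftrightarrow> (\<forall>k. Ck_on k U f)"

text \<open>The space $C_0^\infty(D)$ of complex-valued test functions; its elements are identified
  with their extensions by zero to the whole space.\<close>

definition test_functions :: "(real^'n) set \<Rightarrow> (real^'n \<Rightarrow> complex) set"
  where "test_functions D =
    {\<phi>. smooth_on UNIV \<phi> \<and> compact (closure {x. \<phi> x \<noteq> 0}) \<and> closure {x. \<phi> x \<noteq> 0} \<subseteq> D}"

definition grad :: "(real^'n \<Rightarrow> complex) \<Rightarrow> real^'n \<Rightarrow> complex^'n"
  where "grad f x = (\<chi> i. partial_deriv i f x)"

definition locally_integrable_on :: "(real^'n \<Rightarrow> complex) \<Rightarrow> (real^'n) set \<Rightarrow> bool"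
    (infixr \<open>locally'_integrable'_on\<close> 46)
  where "f locally_integrable_on D \<longleftrightarrow>
    (\<forall>K. compact K \<and> K \<subseteq> D \<longrightarrow> set_integrable lebesgue K f)"

definition square_integrable_on ::
    "(real^'n \<Rightarrow> 'b::euclidean_space) \<Rightarrow> (real^'n) set \<Rightarrow> bool"
    (infixr \<open>square'_integrable'_on\<close> 46)
  where "f square_integrable_on D \<longleftrightarrow>
    f \<in> borel_measurable (lebesgue_on D) \<and> integrable (lebesgue_on D) (\<lambda>x. (norm (f x))\<^sup>2)"

definition has_weak_gradient ::
    "(real^'n) set \<Rightarrow> (real^'n \<Rightarrow> complex) \<Rightarrow> (real^'n \<Rightarrow> complex^'n) \<Rightarrow> bool"
  where "has_weak_gradient D u G \<longleftrightarrow>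
    u locally_integrable_on D \<and>
    (\<forall>i. (\<lambda>x. G x $ i) locally_integrable_on D \<and>
      (\<forall>\<psi>\<in>test_functions D.
        (LINT x|lebesgue_on D. u x * partial_deriv i \<psi> x) =
        - (LINT x|lebesgue_on D. G x $ i * \<psi> x)))"

text \<open>The closure of $C_0^\infty(D)$ with respect to $\|\nabla u\|_2$, for bounded \<^term>\<open>D\<close>.
  On all weakly differentiable functions $\|\nabla u\|_2$ is only a seminorm (it vanishes on
  constants), so the closure is understood as the completion, realised as a space of functions.
  By the Poincare inequality a sequence in $C_0^\infty(D)$ that is Cauchy for the gradient norm
  also converges in $L^2(D)$; its limit there is the element of the completion.\<close>

definition W12_0 :: "(real^'n) set \<Rightarrow> (real^'n \<Rightarrow> complex) set"
  where "W12_0 D =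
    {u. u square_integrable_on D \<and>
      (\<exists>G \<phi>. has_weak_gradient D u G \<and> G square_integrable_on D \<and>
        (\<forall>k::nat. \<phi> k \<in> test_functions D) \<and>
        (\<lambda>k. LINT x|lebesgue_on D. (norm (grad (\<phi> k) x - G x))\<^sup>2) \<longlonglongrightarrow> 0 \<and>
        (\<lambda>k. LINT x|lebesgue_on D. (norm (\<phi> k x - u x))\<^sup>2) \<longlonglongrightarrow> 0)}"

text \<open>Distributional solutions of $-\Delta u = Vu$. The product of gradients is bilinear (no complex
  conjugation). Local integrability of $Vu$ is what makes the right-hand side a distribution.\<close>

definition distributional_solution ::
    "(real^'n) set \<Rightarrow> (real^'n \<Rightarrow> real) \<Rightarrow> (real^'n \<Rightarrow> complex) \<Rightarrow> bool"
  where "distributional_solution D V u \<longleftrightarrow>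
    (\<lambda>x. of_real (V x) * u x) locally_integrable_on D \<and>
    (\<exists>G. has_weak_gradient D u G \<and>
      (\<forall>\<psi>\<in>test_functions D.
        (LINT x|lebesgue_on D. (\<Sum>i\<in>UNIV. G x $ i * grad \<psi> x $ i)) =
        (LINT x|lebesgue_on D. of_real (V x) * u x * \<psi> x)))"

text \<open>Embedded hypersurfaces of class $C^\infty$, not necessarily closed.\<close>

definition smooth_hypersurface :: "(real^'n) set \<Rightarrow> bool"
  where "smooth_hypersurface S \<longleftrightarrow>
    (\<forall>p\<in>S. \<exists>U (f :: real^'n \<Rightarrow> real). open U \<and> p \<in> U \<and> smooth_on U f \<and>
      (\<forall>x\<in>U. \<exists>i. partial_deriv i f x \<noteq> 0) \<and> S \<inter> U = {x\<in>U. f x = 0})"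

text \<open>The boundary consists of finitely many smooth faces together with their edges: the faces are
  relatively open in the boundary and their closures cover it. Smoothness up to the edge of a face
  is not required, so that for instance the apex of a cone is allowed.\<close>

definition piecewise_smooth_boundary :: "(real^'n) set \<Rightarrow> bool"
  where "piecewise_smooth_boundary D \<longleftrightarrow>
    (\<exists>F. finite F \<and> frontier D = (\<Union>S\<in>F. closure S) \<and>
      (\<forall>S\<in>F. smooth_hypersurface S \<and> connected S \<and> openin (top_of_set (frontier D)) S))"

end

theory Submission
  imports Defs
begin

text \<open>In both cases the Hardy inequality behind the bound on \<open>V\<close> improves, on the bounded domain
  \<open>D\<close>, to \<open>\<integral> (w + c) \<bar>\<phi>\<bar>\<^sup>2 \<le> \<integral> \<bar>\<nabla>\<phi>\<bar>\<^sup>2\<close> with some \<open>c > 0\<close>, where \<open>w\<close> is the bound on \<open>\<bar>V\<bar>\<close>.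
  If \<open>\<phi>\<^sub>k \<rightarrow> u\<close> in the gradient norm, testing the equation with the conjugate of \<open>\<phi>\<^sub>k\<close> and
  bounding \<open>\<bar>V u \<phi>\<^sub>k\<bar>\<close> by \<open>w (\<bar>u\<bar>\<^sup>2 + \<bar>\<phi>\<^sub>k\<bar>\<^sup>2) / 2\<close> gives \<open>c \<integral> \<bar>u\<bar>\<^sup>2 \<le> \<integral> \<bar>\<nabla>\<phi>\<^sub>k - \<nabla>u\<bar>\<^sup>2 \<rightarrow> 0\<close>.

  The Hardy inequalities come from \<open>\<integral> (div F - \<bar>F\<bar>\<^sup>2) \<bar>\<phi>\<bar>\<^sup>2 \<le> \<integral> \<bar>\<nabla>\<phi>\<bar>\<^sup>2\<close>, which needs only that each
  component \<open>F\<^sub>i\<close> is differentiable in the direction of the \<open>i\<close>-th axis. In case (i) take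
  \<open>F = (n - 2)/2 x / \<bar>x\<bar>\<^sup>2 + \<beta> x\<close> (regularised at the origin). In case (ii) take
  \<open>F\<^sub>i = (1/q\<^sub>i - 1/p\<^sub>i) / 2\<close>, where \<open>p\<^sub>i\<close> and \<open>q\<^sub>i\<close> are the distances to the boundary in the
  directions \<open>-e\<^sub>i\<close> and \<open>e\<^sub>i\<close>; a supporting hyperplane shows
  \<open>\<Sum>\<^sub>i max (1/p\<^sub>i) (1/q\<^sub>i)\<^sup>2 \<ge> 1/dist\<^sup>2\<close>.\<close>

section \<open>Calculus of test functions: derivatives along an axis, supports, conjugation\<close>

lemma has_vector_derivative_along_axis:
  fixes f :: "real^'n \<Rightarrow> 'b::real_normed_vector"
  assumes "f differentiable (at (x + t *\<^sub>R axis i 1))"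
  shows "((\<lambda>s. f (x + s *\<^sub>R axis i 1)) has_vector_derivative
          partial_deriv i f (x + t *\<^sub>R axis i 1)) (at t)"
proof -
  let ?F = "frechet_derivative f (at (x + t *\<^sub>R axis i 1))"
  have F: "(f has_derivative ?F) (at (x + t *\<^sub>R axis i 1))"
    using assms frechet_derivative_works by blast
  have "((\<lambda>s. x + s *\<^sub>R axis i 1 :: real^'n) has_derivative (\<lambda>s. s *\<^sub>R axis i 1)) (at t)"
    by (auto intro!: derivative_eq_intros)
  from diff_chain_at[OF this F]
  have "((\<lambda>s. f (x + s *\<^sub>R axis i 1)) has_derivative (\<lambda>s. ?F (s *\<^sub>R axis i 1))) (at t)"
    by (simp add: o_def)
  moreover have "?F (s *\<^sub>R axis i 1) = s *\<^sub>R partial_deriv i f (x + t *\<^sub>R axis i 1)" for s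
    using F by (simp add: partial_deriv_def has_derivative_bounded_linear bounded_linear.linear linear_scale)
  ultimately show ?thesis
    by (simp add: has_vector_derivative_def)
qed

lemma partial_deriv_eqI:
  assumes "(f has_derivative F) (at x)"
  shows "partial_deriv i f x = F (axis i 1)"
  using frechet_derivative_at[OF assms] by (simp add: partial_deriv_def)

lemma partial_deriv_eq_0_outside_support:
  fixes f :: "real^'n \<Rightarrow> 'b::real_normed_vector"
  assumes "x \<notin> closure {x. f x \<noteq> 0}"
  shows "partial_deriv i f x = 0"
proof -
  have "(f has_derivative (\<lambda>_. 0)) (at x)"
  proof (rule has_derivative_transform_within_open)
    show "((\<lambda>_. 0 :: 'b) has_derivative (\<lambda>_. 0)) (at x)" by simp
    show "open (- closure {x. f x \<noteq> 0})" by auto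
    show "x \<in> - closure {x. f x \<noteq> 0}" using assms by simp
    show "0 = f y" if "y \<in> - closure {x. f x \<noteq> 0}" for y
      using that closure_subset[of "{x. f x \<noteq> 0}"] by auto
  qed
  from partial_deriv_eqI[OF this] show ?thesis .
qed

lemma test_function_differentiable:
  assumes "\<phi> \<in> test_functions D"
  shows "\<phi> differentiable (at x)"
proof -
  have "Ck_on (Suc 0) UNIV \<phi>"
    using assms unfolding test_functions_def smooth_on_def by blast
  then show ?thesis by simp
qed

lemma test_function_continuous:
  assumes "\<phi> \<in> test_functions D"
  shows "continuous_on A \<phi>"
proof -
  have "Ck_on 0 UNIV \<phi>"
    using assms unfolding test_functions_def smooth_on_def by blast
  then show ?thesis using continuous_on_subset by fastforce
qed

text \<open>\<open>Ck_on\<close> recurses on partial derivatives, so every order of smoothness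
  passes down, and differentiating cannot enlarge the support. This makes derivatives of test
  functions admissible in \<open>has_weak_gradient\<close>.\<close>

lemma partial_deriv_test_function:
  assumes "\<phi> \<in> test_functions D"
  shows "partial_deriv i \<phi> \<in> test_functions D"
proof -
  have *: "closure {x. partial_deriv i \<phi> x \<noteq> 0} \<subseteq> closure {x. \<phi> x \<noteq> 0}"
    using partial_deriv_eq_0_outside_support[of _ \<phi> i]
    by (intro closure_minimal) auto
  have "Ck_on k UNIV (partial_deriv i \<phi>)" for k
  proof -
    have "Ck_on (Suc k) UNIV \<phi>"
      using assms unfolding test_functions_def smooth_on_def by blast
    then show ?thesis by simp
  qed
  moreover have "compact (closure {x. partial_deriv i \<phi> x \<noteq> 0})"
  proof -
    have "compact (closure {x. \<phi> x \<noteq> 0} \<inter> closure {x. partial_deriv i \<phi> x \<noteq> 0})"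
      using assms by (intro compact_Int_closed) (simp_all add: test_functions_def)
    with * show ?thesis by (simp only: Int_absorb1)
  qed
  ultimately show ?thesis
    using * assms unfolding test_functions_def smooth_on_def by blast
qed

lemma partial_deriv_cnj:
  assumes "f differentiable (at x)"
  shows "partial_deriv i (\<lambda>x. cnj (f x)) x = cnj (partial_deriv i f x)"
proof -
  have "(f has_derivative frechet_derivative f (at x)) (at x)"
    using assms frechet_derivative_works by blast
  then have "((\<lambda>x. cnj (f x)) has_derivative (\<lambda>h. cnj (frechet_derivative f (at x) h))) (at x)"
    by (rule has_derivative_cnj)
  from partial_deriv_eqI[OF this] show ?thesis
    by (simp add: partial_deriv_def)
qed

lemma Ck_on_cnj: "Ck_on k UNIV f \<Longrightarrow> Ck_on k UNIV (\<lambda>x. cnj (f x))"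
proof (induction k arbitrary: f)
  case 0
  then show ?case by (simp add: continuous_on_cnj)
next
  case (Suc k)
  have d: "f differentiable (at x)" for x using Suc.prems by simp
  have "(\<lambda>x. cnj (f x)) differentiable (at x)" for x
    using d[of x] has_derivative_cnj unfolding differentiable_def by blast
  moreover have "partial_deriv i (\<lambda>x. cnj (f x)) = (\<lambda>x. cnj (partial_deriv i f x))" for i
    using partial_deriv_cnj[OF d] by auto
  ultimately show ?case using Suc by simp
qed

text \<open>The equation pairs gradients bilinearly. Testing it with a conjugate turns that pairing
  into the Hermitian one, whose real part is the real inner product of gradients.\<close>

lemma cnj_test_function:
  "\<phi> \<in> test_functions D \<Longrightarrow> (\<lambda>x. cnj (\<phi> x)) \<in> test_functions D"
  by (simp add: test_functions_def smooth_on_def Ck_on_cnj)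

lemma grad_cnj:
  "\<phi> \<in> test_functions D \<Longrightarrow> grad (\<lambda>x. cnj (\<phi> x)) x $ i = cnj (grad \<phi> x $ i)"
  by (simp add: grad_def partial_deriv_cnj test_function_differentiable)

lemma test_function_bounded:
  assumes "\<phi> \<in> test_functions D"
  obtains B where "\<And>x. norm (\<phi> x) \<le> B"
proof -
  let ?K = "closure {x. \<phi> x \<noteq> 0}"
  have "compact (\<phi> ` ?K)"
    using assms by (intro compact_continuous_image test_function_continuous)
      (auto simp: test_functions_def)
  then have "bounded (\<phi> ` ?K)" by (rule compact_imp_bounded)
  then obtain B where B: "\<And>x. x \<in> ?K \<Longrightarrow> norm (\<phi> x) \<le> B"
    by (auto simp: bounded_iff)
  have "norm (\<phi> x) \<le> max B 0" for x
    using B[of x] closure_subset[of "{x. \<phi> x \<noteq> 0}"] by (cases "\<phi> x = 0") auto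
  then show thesis by (rule that)
qed

section \<open>Vanishing integrals of directional derivatives\<close>

lemma integrable_bounded_support:
  fixes g :: "'a::euclidean_space \<Rightarrow> 'b::{banach,second_countable_topology}"
  assumes "g \<in> borel_measurable borel" "bounded S"
    and "\<And>x. x \<notin> S \<Longrightarrow> g x = 0" "\<And>x. norm (g x) \<le> B"
  shows "integrable lborel g"
proof -
  obtain a b where ab: "S \<subseteq> cbox a b"
    using assms(2) bounded_subset_cbox_symmetric by metis
  have "integrable lborel (\<lambda>x. indicator (cbox a b) x *\<^sub>R g x)"
    using integrableI_bounded_set_indicator[of "cbox a b" lborel g B] assms
    by (auto simp: emeasure_lborel_cbox_eq)
  moreover have "(\<lambda>x. indicator (cbox a b) x *\<^sub>R g x) = g"
    using ab assms(3) by (fastforce simp: indicator_def)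
  ultimately show ?thesis by simp
qed

text \<open>Translation invariance makes the integral of every difference quotient of \<open>g\<close> vanish.\<close>

lemma integral_derivative_along_line_eq_0:
  fixes g g' :: "'a::euclidean_space \<Rightarrow> real"
  assumes g: "g \<in> borel_measurable borel" and S: "bounded S"
    and g0: "\<And>x. x \<notin> S \<Longrightarrow> g x = 0" and gB: "\<And>x. \<bar>g x\<bar> \<le> B"
    and der: "\<And>x. ((\<lambda>t. g (x + t *\<^sub>R e)) has_real_derivative g' x) (at 0)"
    and g'B: "\<And>x. \<bar>g' x\<bar> \<le> B"
  shows "g' \<in> borel_measurable borel" "(LINT x|lborel. g' x) = 0"
proof -
  define t where "t n = inverse (real (Suc n))" for n
  have t0: "t \<longlonglongrightarrow> 0" unfolding t_def by (rule LIMSEQ_inverse_real_of_nat)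
  have tpos: "0 < t n" "t n \<le> 1" for n by (auto simp: t_def field_simps)
  define q where "q n x = (g (x + t n *\<^sub>R e) - g x) / t n" for n x
  have shift: "g \<in> borel_measurable lborel"
      "(\<lambda>x. g (x + t n *\<^sub>R e)) \<in> borel_measurable borel" for n
    using g by measurable
  have qm: "q n \<in> borel_measurable borel" for n
    unfolding q_def using g shift by measurable
  have lim: "(\<lambda>n. q n x) \<longlonglongrightarrow> g' x" for x
  proof -
    have "((\<lambda>h. (g (x + h *\<^sub>R e) - g x) / h) \<longlongrightarrow> g' x) (at 0)"
      using der[of x] by (simp add: DERIV_def)
    moreover have "filterlim t (at 0) sequentially"
      using t0 tpos by (auto simp: filterlim_at intro!: always_eventually less_imp_neq[THEN not_sym])
    ultimately show ?thesis
      unfolding q_def by (rule filterlim_compose)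
  qed
  show g'm: "g' \<in> borel_measurable borel"
    using qm lim by (rule borel_measurable_LIMSEQ_real[rotated])
  \<comment> \<open>The derivative at parameter 0 is known for every base point, so recentring the
    line gives it at every parameter.\<close>
  have der': "((\<lambda>s. g (x + s *\<^sub>R e)) has_real_derivative g' (x + s *\<^sub>R e)) (at s)" for x s
  proof -
    have "((\<lambda>r. g (x + (r + s) *\<^sub>R e)) has_real_derivative g' (x + s *\<^sub>R e)) (at 0)"
      using der[of "x + s *\<^sub>R e"] by (simp add: algebra_simps)
    then show ?thesis
      using DERIV_shift[of "\<lambda>s. g (x + s *\<^sub>R e)" "g' (x + s *\<^sub>R e)" 0 s] by simp
  qed
  have qB: "\<bar>q n x\<bar> \<le> B" for n x
  proof -
    \<comment> \<open>By the mean value theorem each quotient is a value of \<open>g'\<close>, so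
      the bound on \<open>g'\<close> dominates all quotients at once.\<close>
    obtain z where "g (x + t n *\<^sub>R e) - g (x + 0 *\<^sub>R e) = (t n - 0) * g' (x + z *\<^sub>R e)"
      using MVT2[of 0 "t n" "\<lambda>s. g (x + s *\<^sub>R e)" "\<lambda>s. g' (x + s *\<^sub>R e)"] tpos[of n] der' by auto
    then have "q n x = g' (x + z *\<^sub>R e)" using tpos[of n] by (simp add: q_def)
    then show ?thesis using g'B by simp
  qed
  \<comment> \<open>Since \<open>t n \<le> 1\<close>, enlarging \<open>S\<close> by
    \<open>norm e\<close> catches the supports of all the quotients.\<close>
  define T where "T = (\<Union>x\<in>S. \<Union>y\<in>cball 0 (norm e). {x + y})"
  have T: "bounded T" unfolding T_def using S bounded_cball by (rule bounded_sums)
  have q0: "q n x = 0" if "x \<notin> T" for n x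
  proof -
    have "x \<notin> S" using that by (force simp: T_def)
    moreover have "x + t n *\<^sub>R e \<notin> S"
    proof
      assume "x + t n *\<^sub>R e \<in> S"
      moreover have "- (t n *\<^sub>R e) \<in> cball 0 (norm e)"
        using tpos[of n] by (simp add: mult_left_le_one_le)
      moreover have "x = (x + t n *\<^sub>R e) + - (t n *\<^sub>R e)" by simp
      ultimately show False using that unfolding T_def by blast
    qed
    ultimately show ?thesis by (simp add: q_def g0)
  qed
  have gi: "integrable lborel g"
    using integrable_bounded_support[of g S B] g S g0 gB by simp
  have q_int: "(LINT x|lborel. q n x) = 0" for n
  proof -
    have "distr lborel borel ((+) (t n *\<^sub>R e)) = lborel" by (rule lborel_distr_plus)
    then have "(LINT x|lborel. g x) = (LINT x|distr lborel borel ((+) (t n *\<^sub>R e)). g x)" by simp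
    also have "\<dots> = (LINT x|lborel. g (t n *\<^sub>R e + x))"
      using g by (intro integral_distr) auto
    finally have 1: "(LINT x|lborel. g (x + t n *\<^sub>R e)) = (LINT x|lborel. g x)"
      by (simp add: add.commute)
    have "integrable (distr lborel borel ((+) (t n *\<^sub>R e))) g"
      using gi by (simp add: lborel_distr_plus)
    then have "integrable lborel (\<lambda>x. g (x + t n *\<^sub>R e))"
      using g by (simp add: integrable_distr_eq add.commute)
    with 1 gi show ?thesis by (simp add: q_def)
  qed
  have "(\<lambda>n. LINT x|lborel. q n x) \<longlonglongrightarrow> (LINT x|lborel. g' x)"
  proof (rule integral_dominated_convergence)
    \<comment> \<open>\<open>S\<close>, and with it \<open>T\<close>, is an arbitrary bounded set;
      the closure is Borel and still bounded.\<close>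
    show "integrable lborel (\<lambda>x. B * indicat_real (closure T) x)"
      using emeasure_bounded_finite[OF bounded_closure[OF T]]
      by (intro integrable_mult_right integrable_real_indicator) auto
    show "AE x in lborel. (\<lambda>n. q n x) \<longlonglongrightarrow> g' x" using lim by simp
    show "AE x in lborel. norm (q n x) \<le> B * indicat_real (closure T) x" for n
    proof (intro AE_I2)
      fix x
      have "x \<notin> closure T \<Longrightarrow> x \<notin> T" using closure_subset[of T] by blast
      then show "norm (q n x) \<le> B * indicat_real (closure T) x"
        using qB[of n x] q0[of x n] by (cases "x \<in> closure T") auto
    qed
  qed (use qm g'm in auto)
  then show "(LINT x|lborel. g' x) = 0"
    using q_int by (simp add: LIMSEQ_const_iff)
qed

section \<open>Hardy inequality with the weight generated by a vector field\<close>

lemma test_function_eq_0: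
  assumes "\<phi> \<in> test_functions D" "x \<notin> D"
  shows "\<phi> x = 0"
  using assms closure_subset[of "{x. \<phi> x \<noteq> 0}"] by (auto simp: test_functions_def)

lemma continuous_on_grad:
  assumes "\<phi> \<in> test_functions D"
  shows "continuous_on A (grad \<phi>)"
  unfolding grad_def
  by (intro continuous_on_vec_lambda test_function_continuous[OF partial_deriv_test_function[OF assms]])

lemma grad_eq_0_outside_support:
  "x \<notin> closure {x. \<phi> x \<noteq> 0} \<Longrightarrow> grad \<phi> x = 0"
  by (simp add: grad_def vec_eq_iff partial_deriv_eq_0_outside_support)

lemma norm_grad_power2: "(norm (grad \<phi> x))\<^sup>2 = (\<Sum>i\<in>UNIV. (norm (partial_deriv i \<phi> x))\<^sup>2)"
  by (simp add: norm_vec_def L2_set_def grad_def sum_nonneg)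

lemma integrable_lebesgue_on_supported:
  fixes f :: "'a::euclidean_space \<Rightarrow> 'b::{banach,second_countable_topology}"
  assumes "D \<in> sets lebesgue" "integrable lebesgue f" "\<And>x. x \<notin> D \<Longrightarrow> f x = 0"
  shows "integrable (lebesgue_on D) f"
proof -
  have "(\<lambda>x. indicat_real D x *\<^sub>R f x) = f"
    using assms(3) by (auto simp: indicator_def)
  with assms show ?thesis by (simp add: integrable_restrict_space)
qed

lemma integrable_continuous_compact_support:
  fixes f :: "real^'n \<Rightarrow> 'b::euclidean_space"
  assumes D: "open D" and K: "compact K" "K \<subseteq> D"
    and f: "continuous_on UNIV f" "\<And>x. x \<notin> K \<Longrightarrow> f x = 0"
  shows "integrable (lebesgue_on D) f" "integrable lborel f"
proof -
  have "bounded (f ` K)"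
    by (intro compact_imp_bounded compact_continuous_image K continuous_on_subset[OF f(1)]) auto
  then obtain B where B: "\<And>x. x \<in> K \<Longrightarrow> norm (f x) \<le> B"
    by (auto simp: bounded_iff)
  have "norm (f x) \<le> max B 0" for x
    using B[of x] f(2)[of x] by (cases "x \<in> K") auto
  then show "integrable lborel f"
    using K f by (intro integrable_bounded_support[of f K "max B 0"])
      (auto intro: compact_imp_bounded borel_measurable_continuous_onI)
  then have "integrable lebesgue f"
    using f(1) by (subst integrable_completion) (auto intro: borel_measurable_continuous_onI)
  then show "integrable (lebesgue_on D) f"
    using D K f(2) by (intro integrable_lebesgue_on_supported) auto
qed

text \<open>The nonnegative integral of any function is unchanged by completing the measure. This
  carries estimates made on \<open>lborel\<close>, where translations act, over to
  \<open>lebesgue_on D\<close>.\<close>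

lemma nn_integral_lebesgue_on_supported:
  assumes "open D" "\<And>x. x \<notin> D \<Longrightarrow> f x = 0"
  shows "(\<integral>\<^sup>+x. f x \<partial>lebesgue_on D) = (\<integral>\<^sup>+x. f x \<partial>lborel)"
proof -
  have "(\<integral>\<^sup>+x. f x \<partial>lebesgue_on D) = (\<integral>\<^sup>+x. f x * indicator D x \<partial>lborel)"
    using assms(1) by (simp add: nn_integral_restrict_space nn_integral_completion)
  also have "\<dots> = (\<integral>\<^sup>+x. f x \<partial>lborel)"
    using assms(2) by (intro nn_integral_cong) (auto simp: indicator_def)
  finally show ?thesis .
qed

text \<open>Integrate \<open>\<bar>\<partial>\<^sub>i\<phi> + f \<phi>\<bar>\<^sup>2 \<ge> 0\<close> and integrate the cross term by parts.\<close>

lemma weighted_hardy_along_axis: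
  fixes f f' :: "real^'n \<Rightarrow> real"
  assumes \<phi>: "\<phi> \<in> test_functions D" and D: "open D"
    and m: "f \<in> borel_measurable borel" "f' \<in> borel_measurable borel"
    and der: "\<And>x. x \<in> D \<Longrightarrow> ((\<lambda>t. f (x + t *\<^sub>R axis i 1)) has_real_derivative f' x) (at 0)"
    and bd: "\<And>K. compact K \<Longrightarrow> K \<subseteq> D \<Longrightarrow> \<exists>B. \<forall>x\<in>K. \<bar>f x\<bar> \<le> B \<and> \<bar>f' x\<bar> \<le> B"
  shows "integrable lborel (\<lambda>x. (f' x - (f x)\<^sup>2) * (norm (\<phi> x))\<^sup>2)"
    and "(LINT x|lborel. (f' x - (f x)\<^sup>2) * (norm (\<phi> x))\<^sup>2)
      \<le> (LINT x|lborel. (norm (partial_deriv i \<phi> x))\<^sup>2)"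
proof -
  define K where "K = closure {x. \<phi> x \<noteq> 0}"
  have K: "compact K" "K \<subseteq> D" and \<phi>0: "\<And>x. x \<notin> K \<Longrightarrow> \<phi> x = 0"
    using \<phi> closure_subset[of "{x. \<phi> x \<noteq> 0}"] by (auto simp: test_functions_def K_def)
  let ?d = "partial_deriv i \<phi>"
  have d0: "x \<notin> K \<Longrightarrow> ?d x = 0" for x
    unfolding K_def by (rule partial_deriv_eq_0_outside_support)
  have dt: "?d \<in> test_functions D" using \<phi> by (rule partial_deriv_test_function)
  obtain A where A: "\<And>x. norm (\<phi> x) \<le> A" using test_function_bounded[OF \<phi>] by blast
  obtain A' where A': "\<And>x. norm (?d x) \<le> A'" using test_function_bounded[OF dt] by blast
  obtain B where "\<forall>x\<in>K. \<bar>f x\<bar> \<le> B \<and> \<bar>f' x\<bar> \<le> B" using bd[OF K] by blast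
  then have B: "\<bar>f x\<bar> \<le> B" "\<bar>f' x\<bar> \<le> B" if "x \<in> K" for x using that by auto
  have A0: "0 \<le> A" "0 \<le> A'" using A[of 0] A'[of 0] norm_ge_zero order_trans by blast+
  have [measurable]: "\<phi> \<in> borel_measurable borel" "?d \<in> borel_measurable borel"
    using test_function_continuous[OF \<phi>] test_function_continuous[OF dt]
    by (auto intro: borel_measurable_continuous_onI)
  note [measurable] = m
  define g where "g x = f x * inner (\<phi> x) (\<phi> x)" for x
  \<comment> \<open>This is the derivative along the axis of \<open>f\<close> times the squared
    modulus of \<open>\<phi>\<close>, by the product rule for the real inner product on the complex
    plane. It contains exactly the cross term of the expanded square, so its vanishing integral is
    the integration by parts.\<close>
  define g' where "g' x = f' x * inner (\<phi> x) (\<phi> x) + f x * (2 * inner (\<phi> x) (?d x))" for x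
  define C where "C = B * (A * A) + B * (2 * (A * A')) + B * (A * A)"
  have gm: "g \<in> borel_measurable borel" unfolding g_def by measurable
  have ib: "\<bar>inner (\<phi> x) (\<phi> x)\<bar> \<le> A * A" "\<bar>2 * inner (\<phi> x) (?d x)\<bar> \<le> 2 * (A * A')" for x
    using order_trans[OF Cauchy_Schwarz_ineq2[of "\<phi> x" "\<phi> x"] mult_mono[OF A A]]
      order_trans[OF Cauchy_Schwarz_ineq2[of "\<phi> x" "?d x"] mult_mono[OF A A']] A0 by auto
  have b1: "\<bar>g x\<bar> \<le> C \<and> \<bar>g' x\<bar> \<le> C \<and> 0 \<le> B" if "x \<in> K" for x
  proof -
    have B0: "0 \<le> B" using B[OF that] by linarith
    have 1: "\<bar>f x * inner (\<phi> x) (\<phi> x)\<bar> \<le> B * (A * A)"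
      "\<bar>f' x * inner (\<phi> x) (\<phi> x)\<bar> \<le> B * (A * A)"
      "\<bar>f x * (2 * inner (\<phi> x) (?d x))\<bar> \<le> B * (2 * (A * A'))"
      unfolding abs_mult[of "f x"] abs_mult[of "f' x"]
      using B[OF that] ib[of x] B0 by (intro mult_mono; simp)+
    moreover have "0 \<le> B * (A * A)" "0 \<le> B * (2 * (A * A'))" using B0 A0 by auto
    ultimately show ?thesis unfolding g_def g'_def C_def using B0 by linarith
  qed
  have g0: "g x = 0" "g' x = 0" if "x \<notin> K" for x using \<phi>0[OF that] by (auto simp: g_def g'_def)
  \<comment> \<open>For empty \<open>K\<close> nothing fixes the sign of \<open>B\<close> or of
    \<open>C\<close>; the maximum with 0 bounds both functions off \<open>K\<close> in every
    case.\<close>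
  have b2: "\<bar>g x\<bar> \<le> max C 0" "\<bar>g' x\<bar> \<le> max C 0" for x
    using b1[of x] g0[of x] by (cases "x \<in> K"; force)+
  have gder: "((\<lambda>t. g (x + t *\<^sub>R axis i 1)) has_real_derivative g' x) (at 0)" for x
  proof (cases "x \<in> K")
    case True
    then have "x \<in> D" using K by auto
    have v: "((\<lambda>t. \<phi> (x + t *\<^sub>R axis i 1)) has_vector_derivative ?d x) (at 0)"
      using has_vector_derivative_along_axis[of \<phi> x 0 i] test_function_differentiable[OF \<phi>] by simp
    have "((\<lambda>t. inner (\<phi> (x + t *\<^sub>R axis i 1)) (\<phi> (x + t *\<^sub>R axis i 1))) has_real_derivative
        2 * inner (\<phi> x) (?d x)) (at 0)"
      unfolding has_field_derivative_def
      using has_derivative_inner[OF v[unfolded has_vector_derivative_def] v[unfolded has_vector_derivative_def]]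
      by (rule has_derivative_eq_rhs) (auto simp: fun_eq_iff inner_commute)
    from DERIV_mult[OF der[OF \<open>x \<in> D\<close>] this] show ?thesis
      unfolding g_def g'_def by (simp add: mult.commute)
  next
    \<comment> \<open>Outside \<open>D\<close> the derivative of \<open>f\<close> is not controlled,
      but \<open>g\<close> vanishes on the open complement of \<open>K\<close>.\<close>
    case False
    have "((\<lambda>t. g (x + t *\<^sub>R axis i 1)) has_real_derivative 0) (at 0)"
    proof (rule has_field_derivative_transform_within_open)
      show "((\<lambda>_. 0::real) has_real_derivative 0) (at 0)" by simp
      show "open ((\<lambda>t. x + t *\<^sub>R axis i 1) -` (- K))"
        using K by (intro open_vimage continuous_intros) (auto intro: compact_imp_closed)
      show "0 \<in> (\<lambda>t. x + t *\<^sub>R axis i 1) -` (- K)" using False by simp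
    qed (use g0 in auto)
    then show ?thesis using g0[OF False] by simp
  qed
  have g'm: "g' \<in> borel_measurable borel" and g'I: "(LINT x|lborel. g' x) = 0"
    using integral_derivative_along_line_eq_0[of g K "max C 0" "axis i 1" g']
      gm compact_imp_bounded[OF K(1)] g0 b2 gder by auto
  have g'i: "integrable lborel g'"
    using integrable_bounded_support[of g' K "max C 0"] g'm compact_imp_bounded[OF K(1)] g0 b2 by simp
  have di: "integrable lborel (\<lambda>x. (norm (?d x))\<^sup>2)"
    using K d0 D by (intro integrable_continuous_compact_support(2)[of D K])
      (auto intro!: continuous_intros test_function_continuous[OF dt])
  show int: "integrable lborel (\<lambda>x. (f' x - (f x)\<^sup>2) * (norm (\<phi> x))\<^sup>2)"
  proof (rule integrable_bounded_support)
    show "norm ((f' x - (f x)\<^sup>2) * (norm (\<phi> x))\<^sup>2) \<le> (max B 0 + (max B 0)\<^sup>2) * A\<^sup>2" for x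
    proof (cases "x \<in> K")
      case True
      have "\<bar>f x\<bar>\<^sup>2 \<le> (max B 0)\<^sup>2" using B[OF True] by (intro power_mono) auto
      then have "\<bar>f' x - (f x)\<^sup>2\<bar> \<le> max B 0 + (max B 0)\<^sup>2"
        using B[OF True] zero_le_power2[of "f x"] zero_le_power2[of "max B 0"]
        unfolding power2_abs by linarith
      moreover have "(norm (\<phi> x))\<^sup>2 \<le> A\<^sup>2" using A by (intro power_mono) auto
      ultimately show ?thesis by (simp add: abs_mult mult_mono)
    qed (simp add: \<phi>0)
  qed (use \<phi>0 compact_imp_bounded[OF K(1)] in auto)
  have "(LINT x|lborel. (f' x - (f x)\<^sup>2) * (norm (\<phi> x))\<^sup>2)
      \<le> (LINT x|lborel. (norm (?d x))\<^sup>2 + g' x)"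
  proof (rule integral_mono[OF int])
    fix x
    have "0 \<le> inner (?d x + f x *\<^sub>R \<phi> x) (?d x + f x *\<^sub>R \<phi> x)" by simp
    also have "\<dots> = (norm (?d x))\<^sup>2 + g' x - (f' x - (f x)\<^sup>2) * (norm (\<phi> x))\<^sup>2"
      unfolding g'_def power2_norm_eq_inner
      by (simp add: algebra_simps inner_add_left inner_add_right inner_commute power2_eq_square)
    finally show "(f' x - (f x)\<^sup>2) * (norm (\<phi> x))\<^sup>2 \<le> (norm (?d x))\<^sup>2 + g' x" by simp
  qed (use di g'i in simp)
  also have "\<dots> = (LINT x|lborel. (norm (?d x))\<^sup>2)" using di g'i g'I by simp
  finally show "(LINT x|lborel. (f' x - (f x)\<^sup>2) * (norm (\<phi> x))\<^sup>2)
      \<le> (LINT x|lborel. (norm (?d x))\<^sup>2)" .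
qed

text \<open>The sum of the estimates over all axes: for the field with components
  \<open>f i\<close>, the sum of the \<open>f' i\<close> is its divergence. Stating the result with
  nonnegative integrals suits the later applications of Fatou's lemma.\<close>

lemma weighted_hardy:
  fixes f f' :: "'n \<Rightarrow> real^'n \<Rightarrow> real"
  assumes \<phi>: "\<phi> \<in> test_functions D" and D: "open D"
    and m: "\<And>i. f i \<in> borel_measurable borel" "\<And>i. f' i \<in> borel_measurable borel"
    and der: "\<And>i x. x \<in> D \<Longrightarrow> ((\<lambda>t. f i (x + t *\<^sub>R axis i 1)) has_real_derivative f' i x) (at 0)"
    and bd: "\<And>i K. compact K \<Longrightarrow> K \<subseteq> D \<Longrightarrow> \<exists>B. \<forall>x\<in>K. \<bar>f i x\<bar> \<le> B \<and> \<bar>f' i x\<bar> \<le> B"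
    and W: "\<And>x. x \<in> D \<Longrightarrow> 0 \<le> W x \<and> W x \<le> (\<Sum>i\<in>UNIV. f' i x - (f i x)\<^sup>2)"
  shows "(\<integral>\<^sup>+x. ennreal (W x * (norm (\<phi> x))\<^sup>2) \<partial>lebesgue_on D)
    \<le> (\<integral>\<^sup>+x. ennreal ((norm (grad \<phi> x))\<^sup>2) \<partial>lebesgue_on D)"
proof -
  define K where "K = closure {x. \<phi> x \<noteq> 0}"
  have K: "compact K" "K \<subseteq> D"
    using \<phi> by (auto simp: test_functions_def K_def)
  let ?h = "\<lambda>x. (\<Sum>i\<in>UNIV. (f' i x - (f i x)\<^sup>2) * (norm (\<phi> x))\<^sup>2)"
  have ax: "integrable lborel (\<lambda>x. (f' i x - (f i x)\<^sup>2) * (norm (\<phi> x))\<^sup>2)"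
      "(LINT x|lborel. (f' i x - (f i x)\<^sup>2) * (norm (\<phi> x))\<^sup>2)
        \<le> (LINT x|lborel. (norm (partial_deriv i \<phi> x))\<^sup>2)" for i
    using weighted_hardy_along_axis[OF \<phi> D m der bd] by blast+
  have Wh: "W x * (norm (\<phi> x))\<^sup>2 \<le> ?h x \<and> 0 \<le> ?h x" for x
    using W[of x] test_function_eq_0[OF \<phi>, of x]
    by (cases "x \<in> D") (auto simp flip: sum_distrib_right intro: mult_right_mono mult_nonneg_nonneg order_trans)
  have gc: "continuous_on UNIV (\<lambda>x. (norm (partial_deriv i \<phi> x))\<^sup>2)" for i
    by (intro continuous_intros test_function_continuous[OF partial_deriv_test_function[OF \<phi>]])
  have gi: "integrable lborel (\<lambda>x. (norm (partial_deriv i \<phi> x))\<^sup>2)" for i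
    using gc by (intro integrable_continuous_compact_support(2)[OF D K])
       (auto simp: K_def partial_deriv_eq_0_outside_support)
  have "(\<integral>\<^sup>+x. ennreal (W x * (norm (\<phi> x))\<^sup>2) \<partial>lebesgue_on D)
      = (\<integral>\<^sup>+x. ennreal (W x * (norm (\<phi> x))\<^sup>2) \<partial>lborel)"
    by (intro nn_integral_lebesgue_on_supported D) (simp add: test_function_eq_0[OF \<phi>])
  also have "\<dots> \<le> (\<integral>\<^sup>+x. ennreal (?h x) \<partial>lborel)"
    using Wh by (intro nn_integral_mono ennreal_leI) auto
  also have "\<dots> = ennreal (LINT x|lborel. ?h x)"
    using ax(1) Wh by (intro nn_integral_eq_integral Bochner_Integration.integrable_sum) auto
  also have "(LINT x|lborel. ?h x) \<le> (\<Sum>i\<in>UNIV. LINT x|lborel. (norm (partial_deriv i \<phi> x))\<^sup>2)"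
    using ax by (subst Bochner_Integration.integral_sum) (auto intro: sum_mono)
  also have "\<dots> = (LINT x|lborel. (norm (grad \<phi> x))\<^sup>2)"
    unfolding norm_grad_power2 using gi by (subst Bochner_Integration.integral_sum) auto
  also have "ennreal \<dots> = (\<integral>\<^sup>+x. ennreal ((norm (grad \<phi> x))\<^sup>2) \<partial>lborel)"
    unfolding norm_grad_power2 using gi
    by (intro nn_integral_eq_integral[symmetric] Bochner_Integration.integrable_sum) (simp_all add: sum_nonneg)
  also have "\<dots> = (\<integral>\<^sup>+x. ennreal ((norm (grad \<phi> x))\<^sup>2) \<partial>lebesgue_on D)"
    using K by (intro nn_integral_lebesgue_on_supported[symmetric] D)
      (auto simp: K_def intro!: grad_eq_0_outside_support)
  finally show ?thesis by (simp add: ennreal_leI)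
qed

section \<open>From a Hardy inequality with a positive surplus to the absence of solutions\<close>

lemma integrable_norm_diff_power2:
  fixes f g :: "'a \<Rightarrow> 'b::euclidean_space"
  assumes "f \<in> borel_measurable M" "g \<in> borel_measurable M"
    and "integrable M (\<lambda>x. (norm (f x))\<^sup>2)" "integrable M (\<lambda>x. (norm (g x))\<^sup>2)"
  shows "integrable M (\<lambda>x. (norm (f x - g x))\<^sup>2)"
proof (rule Bochner_Integration.integrable_bound)
  show "integrable M (\<lambda>x. 2 * (norm (f x))\<^sup>2 + 2 * (norm (g x))\<^sup>2)"
    using assms by simp
  show "AE x in M. norm ((norm (f x - g x))\<^sup>2) \<le> norm (2 * (norm (f x))\<^sup>2 + 2 * (norm (g x))\<^sup>2)"
  proof (intro AE_I2)
    fix x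
    have "(norm (f x - g x))\<^sup>2 + (norm (f x + g x))\<^sup>2 = 2 * (norm (f x))\<^sup>2 + 2 * (norm (g x))\<^sup>2"
      by (simp add: power2_norm_eq_inner inner_add_left inner_add_right inner_diff_left inner_diff_right inner_commute)
    moreover have "0 \<le> (norm (f x + g x))\<^sup>2" by simp
    ultimately have "(norm (f x - g x))\<^sup>2 \<le> 2 * (norm (f x))\<^sup>2 + 2 * (norm (g x))\<^sup>2"
      by linarith
    then show "norm ((norm (f x - g x))\<^sup>2) \<le> norm (2 * (norm (f x))\<^sup>2 + 2 * (norm (g x))\<^sup>2)"
      by simp
  qed
qed (use assms in measurable)

text \<open>Young's inequality with parameter: expand the square of \<open>sqrt \<eta>\<close> times
  \<open>b\<close> minus \<open>(a - b) / sqrt \<eta>\<close>. Integrated, it compares the energies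
  of the approximants with that of the limit; \<open>k\<close> tends to infinity first, then
  \<open>\<eta>\<close> to 0.\<close>

lemma norm_power2_le_weighted:
  fixes a b :: "'a::real_inner"
  assumes "0 < \<eta>"
  shows "(norm a)\<^sup>2 \<le> (1 + \<eta>) * (norm b)\<^sup>2 + (1 + 1 / \<eta>) * (norm (a - b))\<^sup>2"
proof -
  define s where "s = sqrt \<eta>"
  have s: "0 < s" "\<eta> = s\<^sup>2" using assms by (auto simp: s_def)
  have "inner (s *\<^sub>R b - (1 / s) *\<^sub>R d) (s *\<^sub>R b - (1 / s) *\<^sub>R d)
      = s\<^sup>2 * inner b b - 2 * inner b d + inner d d / s\<^sup>2" for d
    using s by (simp add: inner_diff_left inner_diff_right inner_commute power2_eq_square)
  then have "0 \<le> s\<^sup>2 * inner b b - 2 * inner b (a - b) + inner (a - b) (a - b) / s\<^sup>2"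
    by (metis inner_ge_zero)
  then have "2 * inner b (a - b) \<le> \<eta> * inner b b + inner (a - b) (a - b) / \<eta>"
    using s by simp
  moreover have "inner a a = inner b b + 2 * inner b (a - b) + inner (a - b) (a - b)"
    by (simp add: inner_diff_left inner_diff_right inner_commute)
  ultimately show ?thesis
    by (simp add: power2_norm_eq_inner distrib_right)
qed

text \<open>On the compact support of \<open>\<psi>\<close> the function \<open>G\<close> is
  integrable and \<open>\<psi>\<close> is bounded, so \<open>G\<close> may be cut off by the
  indicator of that support.\<close>

lemma integrable_times_test_function:
  assumes G: "G locally_integrable_on D" and \<psi>: "\<psi> \<in> test_functions D" and D: "open D"
  shows "integrable (lebesgue_on D) (\<lambda>x. G x * \<psi> x)"
proof -
  define K where "K = closure {x. \<psi> x \<noteq> 0}"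
  have K: "compact K" "K \<subseteq> D" and \<psi>0: "\<And>x. x \<notin> K \<Longrightarrow> \<psi> x = 0"
    using \<psi> closure_subset[of "{x. \<psi> x \<noteq> 0}"] by (auto simp: test_functions_def K_def)
  obtain B where B: "\<And>x. norm (\<psi> x) \<le> B" using test_function_bounded[OF \<psi>] by blast
  have i: "integrable lebesgue (\<lambda>x. indicat_real K x *\<^sub>R G x)"
    using G K unfolding locally_integrable_on_def set_integrable_def by blast
  have "\<psi> \<in> borel_measurable lborel"
    using test_function_continuous[OF \<psi>] by (simp add: borel_measurable_continuous_onI)
  then have [measurable]: "\<psi> \<in> borel_measurable lebesgue" by (rule measurable_completion)
  have "integrable lebesgue (\<lambda>x. (indicat_real K x *\<^sub>R G x) * \<psi> x)"
  proof (rule Bochner_Integration.integrable_bound)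
    show "integrable lebesgue (\<lambda>x. B *\<^sub>R (indicat_real K x *\<^sub>R G x))"
      using i by (rule integrable_scaleR_right)
    show "AE x in lebesgue. norm ((indicat_real K x *\<^sub>R G x) * \<psi> x)
        \<le> norm (B *\<^sub>R (indicat_real K x *\<^sub>R G x))"
    proof (intro AE_I2)
      fix x
      have "norm (\<psi> x) \<le> \<bar>B\<bar>" using B[of x] by linarith
      then have "norm (indicat_real K x *\<^sub>R G x) * norm (\<psi> x) \<le> norm (indicat_real K x *\<^sub>R G x) * \<bar>B\<bar>"
        by (intro mult_left_mono) auto
      then show "norm ((indicat_real K x *\<^sub>R G x) * \<psi> x) \<le> norm (B *\<^sub>R (indicat_real K x *\<^sub>R G x))"
        by (simp add: norm_mult abs_mult mult_ac)
    qed
    show "(\<lambda>x. (indicat_real K x *\<^sub>R G x) * \<psi> x) \<in> borel_measurable lebesgue"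
      using borel_measurable_integrable[OF i] by measurable
  qed
  moreover have "(\<lambda>x. (indicat_real K x *\<^sub>R G x) * \<psi> x) = (\<lambda>x. G x * \<psi> x)"
    using \<psi>0 by (auto simp: indicator_def fun_eq_iff)
  ultimately have "integrable lebesgue (\<lambda>x. G x * \<psi> x)" by simp
  then show ?thesis
    using D test_function_eq_0[OF \<psi>] by (intro integrable_lebesgue_on_supported) auto
qed

text \<open>Since \<open>\<partial>\<^sub>i\<psi>\<close> is again a test function, two weak gradients of the same function
  need not be compared almost everywhere.\<close>

lemma weak_gradients_agree:
  assumes G: "has_weak_gradient D u G" and G': "has_weak_gradient D u G'"
    and \<psi>: "\<psi> \<in> test_functions D" and D: "open D"
  shows "(LINT x|lebesgue_on D. (\<Sum>i\<in>UNIV. G x $ i * grad \<psi> x $ i))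
       = (LINT x|lebesgue_on D. (\<Sum>i\<in>UNIV. G' x $ i * grad \<psi> x $ i))"
proof -
  have *: "(LINT x|lebesgue_on D. (\<Sum>i\<in>UNIV. G x $ i * grad \<psi> x $ i))
      = (\<Sum>i\<in>UNIV. - (LINT x|lebesgue_on D. u x * partial_deriv i (partial_deriv i \<psi>) x))"
    if "has_weak_gradient D u G" for G
  proof -
    have "(LINT x|lebesgue_on D. (\<Sum>i\<in>UNIV. G x $ i * partial_deriv i \<psi> x))
        = (\<Sum>i\<in>UNIV. LINT x|lebesgue_on D. G x $ i * partial_deriv i \<psi> x)"
      using that integrable_times_test_function[OF _ partial_deriv_test_function[OF \<psi>] D]
      by (intro Bochner_Integration.integral_sum) (auto simp: has_weak_gradient_def)
    also have "\<dots> = (\<Sum>i\<in>UNIV. - (LINT x|lebesgue_on D. u x * partial_deriv i (partial_deriv i \<psi>) x))"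
      using that partial_deriv_test_function[OF \<psi>] by (simp add: has_weak_gradient_def)
    finally show ?thesis by (simp add: grad_def)
  qed
  show ?thesis using *[OF G] *[OF G'] by simp
qed

text \<open>Let \<open>A\<close>, \<open>P k\<close> and \<open>a k\<close> be the squared norms of
  \<open>G\<close>, of \<open>grad (\<phi> k)\<close> and of their difference. Polarisation makes
  the left side of the tested equation \<open>(A + P k - a k) / 2\<close>, while the Hardy
  inequalities for \<open>u\<close> and \<open>\<phi> k\<close> bound the right side by
  \<open>(A + P k) / 2\<close> minus half of \<open>c\<close> times the squared norm of
  \<open>u\<close>. The energies cancel and only \<open>a k\<close> remains.\<close>

lemma hardy_imp_no_solution:
  fixes D :: "(real^'n) set" and V w :: "real^'n \<Rightarrow> real"
  assumes D: "open D"
    and V: "V \<in> borel_measurable (lebesgue_on D)" and w: "w \<in> borel_measurable (lebesgue_on D)"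
    and Vw: "AE x in lebesgue_on D. \<bar>V x\<bar> \<le> w x"
    and w0: "\<And>x. 0 \<le> w x" and c: "0 < c"
    and hardy: "\<And>\<phi>. \<phi> \<in> test_functions D \<Longrightarrow>
      (\<integral>\<^sup>+x. ennreal ((w x + c) * (norm (\<phi> x))\<^sup>2) \<partial>lebesgue_on D)
      \<le> (\<integral>\<^sup>+x. ennreal ((norm (grad \<phi> x))\<^sup>2) \<partial>lebesgue_on D)"
    and u: "u \<in> W12_0 D" and sol: "distributional_solution D V u"
  shows "AE x in lebesgue_on D. u x = 0"
proof -
  let ?M = "lebesgue_on D"
  note [measurable] = V w
  obtain G \<phi> where um [measurable]: "u \<in> borel_measurable ?M"
    and ui: "integrable ?M (\<lambda>x. (norm (u x))\<^sup>2)"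
    and wg: "has_weak_gradient D u G"
    and Gm [measurable]: "G \<in> borel_measurable ?M"
    and Gi: "integrable ?M (\<lambda>x. (norm (G x))\<^sup>2)"
    and \<phi>: "\<And>k. \<phi> k \<in> test_functions D"
    and lim1: "(\<lambda>k. LINT x|?M. (norm (grad (\<phi> k) x - G x))\<^sup>2) \<longlonglongrightarrow> 0"
    and lim0: "(\<lambda>k. LINT x|?M. (norm (\<phi> k x - u x))\<^sup>2) \<longlonglongrightarrow> 0"
    using u unfolding W12_0_def square_integrable_on_def by auto
  obtain G' where wg': "has_weak_gradient D u G'"
    and eq': "\<And>\<psi>. \<psi> \<in> test_functions D \<Longrightarrow>
        (LINT x|?M. (\<Sum>i\<in>UNIV. G' x $ i * grad \<psi> x $ i))
        = (LINT x|?M. of_real (V x) * u x * \<psi> x)"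
    using sol unfolding distributional_solution_def by blast
  \<comment> \<open>The equation comes with some weak gradient \<open>G'\<close>, whereas the
    gradients of the approximants converge to \<open>G\<close>; the equation is transferred to
    \<open>G\<close>.\<close>
  have eq: "(LINT x|?M. (\<Sum>i\<in>UNIV. G x $ i * grad \<psi> x $ i))
      = (LINT x|?M. of_real (V x) * u x * \<psi> x)" if "\<psi> \<in> test_functions D" for \<psi>
    using weak_gradients_agree[OF wg wg' that D] eq'[OF that] by simp

  have supp: "compact (closure {x. \<phi> k x \<noteq> 0})" "closure {x. \<phi> k x \<noteq> 0} \<subseteq> D" for k
    using \<phi>[of k] by (auto simp: test_functions_def)
  have \<phi>m [measurable]: "\<phi> k \<in> borel_measurable ?M" "grad (\<phi> k) \<in> borel_measurable ?M" for k
    using test_function_continuous[OF \<phi>] continuous_on_grad[OF \<phi>] 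
    by (auto intro!: measurable_restrict_space1 measurable_completion borel_measurable_continuous_onI)
  have \<phi>i: "integrable ?M (\<lambda>x. (norm (\<phi> k x))\<^sup>2)" for k
    by (rule integrable_continuous_compact_support(1)[OF D supp[of k]])
      (use test_function_continuous[OF \<phi>] closure_subset[of "{x. \<phi> k x \<noteq> 0}"] in \<open>auto intro!: continuous_intros\<close>)
  have gi: "integrable ?M (\<lambda>x. (norm (grad (\<phi> k) x))\<^sup>2)" for k
    by (rule integrable_continuous_compact_support(1)[OF D supp[of k]])
      (use continuous_on_grad[OF \<phi>] grad_eq_0_outside_support in \<open>auto intro!: continuous_intros\<close>)
  have d1i: "integrable ?M (\<lambda>x. (norm (grad (\<phi> k) x - G x))\<^sup>2)" for k
    by (intro integrable_norm_diff_power2 gi Gi \<phi>m Gm)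
  have d0i: "integrable ?M (\<lambda>x. (norm (\<phi> k x - u x))\<^sup>2)" for k
    by (intro integrable_norm_diff_power2 \<phi>i ui \<phi>m um)
  define A where "A = (LINT x|?M. (norm (G x))\<^sup>2)"
  define P where "P k = (LINT x|?M. (norm (grad (\<phi> k) x))\<^sup>2)" for k
  define a where "a k = (LINT x|?M. (norm (grad (\<phi> k) x - G x))\<^sup>2)" for k
  have a0: "a \<longlonglongrightarrow> 0" "0 \<le> a k" for k using lim1 by (auto simp: a_def[abs_def])
  have A0: "0 \<le> A" by (simp add: A_def)

  have hardy_k: "(\<integral>\<^sup>+x. ennreal ((w x + c) * (norm (\<phi> k x))\<^sup>2) \<partial>?M) \<le> ennreal (P k)" for k
    using hardy[OF \<phi>[of k]] nn_integral_eq_integral[OF gi[of k]] by (simp add: P_def)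
  have PA: "P k \<le> (1 + \<eta>) * A + (1 + 1 / \<eta>) * a k" if "0 < \<eta>" for \<eta> k
  proof -
    have "P k \<le> (LINT x|?M. (1 + \<eta>) * (norm (G x))\<^sup>2 + (1 + 1 / \<eta>) * (norm (grad (\<phi> k) x - G x))\<^sup>2)"
      unfolding P_def using that gi Gi d1i
      by (intro integral_mono norm_power2_le_weighted) auto
    then show ?thesis using Gi d1i by (simp add: A_def a_def)
  qed
  have hardy_u: "(\<integral>\<^sup>+x. ennreal ((w x + c) * (norm (u x))\<^sup>2) \<partial>?M) \<le> ennreal A"
  proof -
    \<comment> \<open>Convergence in mean square yields only a subsequence converging almost
      everywhere, which suffices for Fatou's lemma.\<close>
    obtain r where r: "strict_mono r" and ae: "AE x in ?M. (\<lambda>n. (norm (\<phi> (r n) x - u x))\<^sup>2) \<longlonglongrightarrow> 0"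
      using tendsto_L1_AE_subseq[of ?M "\<lambda>k x. (norm (\<phi> k x - u x))\<^sup>2"] d0i lim0 by auto
    have "(\<integral>\<^sup>+x. ennreal ((w x + c) * (norm (u x))\<^sup>2) \<partial>?M)
        = (\<integral>\<^sup>+x. liminf (\<lambda>n. ennreal ((w x + c) * (norm (\<phi> (r n) x))\<^sup>2)) \<partial>?M)"
    proof (rule nn_integral_cong_AE)
      show "AE x in ?M. ennreal ((w x + c) * (norm (u x))\<^sup>2)
          = liminf (\<lambda>n. ennreal ((w x + c) * (norm (\<phi> (r n) x))\<^sup>2))"
        using ae
      proof eventually_elim
        case (elim x)
        have "(\<lambda>n. sqrt ((norm (\<phi> (r n) x - u x))\<^sup>2)) \<longlonglongrightarrow> sqrt 0"
          using elim by (rule tendsto_real_sqrt)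
        then have "(\<lambda>n. \<phi> (r n) x) \<longlonglongrightarrow> u x"
          by (simp add: LIM_zero_cancel tendsto_norm_zero_iff)
        then have "(\<lambda>n. ennreal ((w x + c) * (norm (\<phi> (r n) x))\<^sup>2))
            \<longlonglongrightarrow> ennreal ((w x + c) * (norm (u x))\<^sup>2)"
          by (intro tendsto_intros tendsto_ennrealI)
        then show ?case by (simp add: lim_imp_Liminf)
      qed
    qed
    also have "\<dots> \<le> liminf (\<lambda>n. \<integral>\<^sup>+x. ennreal ((w x + c) * (norm (\<phi> (r n) x))\<^sup>2) \<partial>?M)"
      by (intro nn_integral_liminf) measurable
    also have "\<dots> \<le> liminf (\<lambda>n. ennreal (P (r n)))"
      by (intro Liminf_mono always_eventually allI hardy_k)
    also have "\<dots> \<le> ennreal A"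
    proof (rule ennreal_le_epsilon)
      fix e :: real assume e: "0 < e"
      \<comment> \<open>Chosen so that \<open>\<eta> * A \<le> e\<close>; the added 1 covers
        \<open>A = 0\<close>.\<close>
      define \<eta> where "\<eta> = e / (A + 1)"
      have \<eta>: "0 < \<eta>" "\<eta> * A \<le> e"
        using e A0 by (auto simp: \<eta>_def field_simps)
      have ar: "(\<lambda>n. a (r n)) \<longlonglongrightarrow> 0"
        using LIMSEQ_subseq_LIMSEQ[OF a0(1) r] by (simp add: o_def)
      have "(\<lambda>n. ennreal ((1 + \<eta>) * A + (1 + 1 / \<eta>) * a (r n)))
          \<longlonglongrightarrow> ennreal ((1 + \<eta>) * A + (1 + 1 / \<eta>) * 0)"
        by (intro tendsto_ennrealI tendsto_intros ar)
      then have "liminf (\<lambda>n. ennreal ((1 + \<eta>) * A + (1 + 1 / \<eta>) * a (r n))) = ennreal ((1 + \<eta>) * A)"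
        by (simp add: lim_imp_Liminf)
      moreover have "liminf (\<lambda>n. ennreal (P (r n)))
          \<le> liminf (\<lambda>n. ennreal ((1 + \<eta>) * A + (1 + 1 / \<eta>) * a (r n)))"
        using PA[OF \<eta>(1)] by (intro Liminf_mono always_eventually allI ennreal_leI)
      moreover have "ennreal ((1 + \<eta>) * A) \<le> ennreal A + ennreal e"
        using \<eta> A0 e by (simp flip: ennreal_plus add: ennreal_leI algebra_simps)
      ultimately show "liminf (\<lambda>n. ennreal (P (r n))) \<le> ennreal A + ennreal e" by simp
    qed
    finally show ?thesis .
  qed

  \<comment> \<open>Finiteness of the weighted integral is a consequence of Hardy's inequality. It
    is extracted once, for use with \<open>u\<close> and with every \<open>\<phi> k\<close>, and
    lets the term with \<open>c\<close> be separated in real arithmetic.\<close>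
  have fin: "integrable ?M (\<lambda>x. w x * (norm (v x))\<^sup>2)"
    "(LINT x|?M. w x * (norm (v x))\<^sup>2) \<le> R - c * (LINT x|?M. (norm (v x))\<^sup>2)"
    if R: "0 \<le> R" "(\<integral>\<^sup>+x. ennreal ((w x + c) * (norm (v x))\<^sup>2) \<partial>?M) \<le> ennreal R"
      and [measurable]: "v \<in> borel_measurable ?M" and vi: "integrable ?M (\<lambda>x. (norm (v x))\<^sup>2)"
    for R and v :: "real^'n \<Rightarrow> complex"
  proof -
    have i: "integrable ?M (\<lambda>x. (w x + c) * (norm (v x))\<^sup>2)"
      using R w0 c by (intro integrableI_nonneg) (auto intro: le_less_trans add_nonneg_nonneg)
    have "ennreal (LINT x|?M. (w x + c) * (norm (v x))\<^sup>2) \<le> ennreal R"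
      using R(2) nn_integral_eq_integral[OF i] w0 c by (simp add: add_nonneg_nonneg)
    then have le: "(LINT x|?M. (w x + c) * (norm (v x))\<^sup>2) \<le> R"
      using R(1) by (simp add: ennreal_le_iff)
    have "integrable ?M (\<lambda>x. (w x + c) * (norm (v x))\<^sup>2 - c * (norm (v x))\<^sup>2)"
      using i vi by simp
    then show wi: "integrable ?M (\<lambda>x. w x * (norm (v x))\<^sup>2)" by (simp add: algebra_simps)
    then have "(LINT x|?M. (w x + c) * (norm (v x))\<^sup>2)
        = (LINT x|?M. w x * (norm (v x))\<^sup>2) + c * (LINT x|?M. (norm (v x))\<^sup>2)"
      using vi by (simp add: distrib_right)
    with le show "(LINT x|?M. w x * (norm (v x))\<^sup>2) \<le> R - c * (LINT x|?M. (norm (v x))\<^sup>2)" by simp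
  qed

  have main: "c * (LINT x|?M. (norm (u x))\<^sup>2) \<le> a k" for k
  proof -
    let ?\<psi> = "\<lambda>x. cnj (\<phi> k x)"
    have P0: "0 \<le> P k" by (simp add: P_def)
    note fu = fin[OF A0 hardy_u um ui] and f\<phi> = fin[OF P0 hardy_k \<phi>m(1) \<phi>i]
    \<comment> \<open>Polarisation, so that the cross term is expressed by the three
      energies.\<close>
    have in_eq: "inner (G x) (grad (\<phi> k) x)
        = ((norm (G x))\<^sup>2 + (norm (grad (\<phi> k) x))\<^sup>2 - (norm (grad (\<phi> k) x - G x))\<^sup>2) / 2" for x
      unfolding power2_norm_eq_inner by (simp add: inner_diff_left inner_diff_right inner_commute)
    have "(A + P k - a k) / 2 = (LINT x|?M. inner (G x) (grad (\<phi> k) x))"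
      unfolding in_eq A_def P_def a_def using Gi gi d1i by simp
    also have "\<dots> = (LINT x|?M. Re (\<Sum>i\<in>UNIV. G x $ i * grad ?\<psi> x $ i))"
      by (simp add: inner_vec_def grad_cnj[OF \<phi>] inner_complex_def)
    also have "\<dots> = Re (LINT x|?M. (\<Sum>i\<in>UNIV. G x $ i * grad ?\<psi> x $ i))"
    proof (rule integral_Re)
      show "integrable ?M (\<lambda>x. \<Sum>i\<in>UNIV. G x $ i * grad ?\<psi> x $ i)"
        using wg integrable_times_test_function[OF _ partial_deriv_test_function[OF cnj_test_function[OF \<phi>]] D]
        by (intro Bochner_Integration.integrable_sum) (auto simp: has_weak_gradient_def grad_def)
    qed
    also have "\<dots> = Re (LINT x|?M. of_real (V x) * u x * ?\<psi> x)"
      using eq[OF cnj_test_function[OF \<phi>]] by simp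
    also have "\<dots> \<le> (LINT x|?M. norm (of_real (V x) * u x * ?\<psi> x))"
      using complex_Re_le_cmod integral_norm_bound order_trans by blast
    also have "\<dots> \<le> (LINT x|?M. (w x * (norm (u x))\<^sup>2 + w x * (norm (\<phi> k x))\<^sup>2) / 2)"
    proof (rule integral_mono_AE')
      show "AE x in ?M. norm (of_real (V x) * u x * ?\<psi> x)
          \<le> (w x * (norm (u x))\<^sup>2 + w x * (norm (\<phi> k x))\<^sup>2) / 2"
        using Vw
      proof eventually_elim
        case (elim x)
        have "norm (of_real (V x) * u x * ?\<psi> x) = \<bar>V x\<bar> * (norm (u x) * norm (\<phi> k x))"
          by (simp add: norm_mult)
        also have "\<dots> \<le> w x * (norm (u x) * norm (\<phi> k x))"
          using elim by (intro mult_right_mono) auto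
        also have "\<dots> \<le> w x * (((norm (u x))\<^sup>2 + (norm (\<phi> k x))\<^sup>2) / 2)"
          using w0 sum_squares_bound[of "norm (u x)" "norm (\<phi> k x)"] by (intro mult_left_mono) auto
        finally show ?case by (simp add: distrib_left)
      qed
    qed (use fu f\<phi> w0 in \<open>auto intro!: AE_I2 add_nonneg_nonneg\<close>)
    also have "\<dots> = ((LINT x|?M. w x * (norm (u x))\<^sup>2) + (LINT x|?M. w x * (norm (\<phi> k x))\<^sup>2)) / 2"
      using fu f\<phi> by simp
    also have "\<dots> \<le> (A - c * (LINT x|?M. (norm (u x))\<^sup>2) + P k) / 2"
    proof -
      \<comment> \<open>The surplus belonging to \<open>\<phi> k\<close> is discarded; the one
        belonging to \<open>u\<close> is kept.\<close>
      have "0 \<le> c * (LINT x|?M. (norm (\<phi> k x))\<^sup>2)" using c by simp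
      moreover have "(X + Y) / 2 \<le> (A - y + P k) / 2"
        if "0 \<le> z" "X \<le> A - y" "Y \<le> P k - z" for X Y y z :: real
        using that by simp
      ultimately show ?thesis using fu(2) f\<phi>(2) by blast
    qed
    finally show ?thesis by simp
  qed
  have "c * (LINT x|?M. (norm (u x))\<^sup>2) \<le> 0"
    using LIMSEQ_le_const[OF a0(1)] main by blast
  then have "(LINT x|?M. (norm (u x))\<^sup>2) = 0"
    using c by (simp add: mult_le_0_iff antisym)
  then have "AE x in ?M. (norm (u x))\<^sup>2 = 0"
    using integral_nonneg_eq_0_iff_AE[OF ui] by simp
  then show ?thesis by simp
qed

section \<open>The inverse-square potential\<close>

text \<open>With \<open>r\<close> the squared norm of \<open>x\<close> and
  \<open>s = r + \<epsilon>\<close>, the right side is the divergence minus the squared length of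
  the field \<open>(a / s + \<beta>) x\<close> in dimension \<open>n\<close>. Bounding
  \<open>r / s\<close> and \<open>\<beta> * r\<close> by 1 in the negative terms leaves the left
  side, because \<open>n = 2 * a + 2\<close>.\<close>

lemma inverse_square_field_estimate:
  fixes a \<beta> r s n :: real
  assumes "0 \<le> a" "0 < \<beta>" "0 < s" "0 \<le> r" "r \<le> s" "\<beta> * r \<le> 1" "n = 2 * a + 2"
  shows "a\<^sup>2 / s + \<beta> \<le> n * (a / s + \<beta>) - 2 * a * r / s\<^sup>2 - (a / s + \<beta>)\<^sup>2 * r"
proof -
  define y where "y = 1 / s"
  have y: "0 < y" "r * y \<le> 1" using assms by (auto simp: y_def field_simps)
  have "(a * a + 2 * a) * y * (r * y) \<le> (a * a + 2 * a) * y * 1"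
    using assms y by (intro mult_left_mono mult_nonneg_nonneg add_nonneg_nonneg) auto
  moreover have "2 * a * \<beta> * (r * y) \<le> 2 * a * \<beta> * 1"
    using assms y by (intro mult_left_mono) auto
  moreover have "\<beta> * (\<beta> * r) \<le> \<beta> * 1"
    using assms by (intro mult_left_mono) auto
  ultimately have "a * a * y + \<beta> \<le> n * (a * y + \<beta>) - 2 * a * r * (y * y) - (a * y + \<beta>) * (a * y + \<beta>) * r"
    unfolding assms(7) by (simp add: algebra_simps)
  then show ?thesis by (simp add: y_def power2_eq_square)
qed

text \<open>The term \<open>\<epsilon>\<close> keeps the denominator positive, so the field is
  regular also when the origin lies in \<open>D\<close>. Its linear part with coefficient
  \<open>\<beta>\<close> produces the surplus.\<close>

lemma improved_hardy_regularized:
  fixes D :: "(real^'n) set"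
  defines "a \<equiv> (real CARD('n) - 2) / 2"
  assumes n: "CARD('n) \<ge> 2" and D: "open D" and \<beta>: "0 < \<beta>" "\<And>x. x \<in> D \<Longrightarrow> \<beta> * (norm x)\<^sup>2 \<le> 1"
    and \<phi>: "\<phi> \<in> test_functions D" and \<epsilon>: "0 < \<epsilon>"
  shows "(\<integral>\<^sup>+x. ennreal ((a\<^sup>2 / ((norm x)\<^sup>2 + \<epsilon>) + \<beta>) * (norm (\<phi> x))\<^sup>2) \<partial>lebesgue_on D)
    \<le> (\<integral>\<^sup>+x. ennreal ((norm (grad \<phi> x))\<^sup>2) \<partial>lebesgue_on D)"
proof -
  have a0: "0 \<le> a" using n by (simp add: a_def)
  define s :: "real^'n \<Rightarrow> real" where "s x = (norm x)\<^sup>2 + \<epsilon>" for x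
  have s0: "0 < s x" for x using \<epsilon> by (simp add: s_def add_nonneg_pos)
  then have sne: "s x \<noteq> 0" for x using less_irrefl by metis
  have sc: "continuous_on A s" for A unfolding s_def by (intro continuous_intros)
  define f where "f i x = a * (x $ i) / s x + \<beta> * (x $ i)" for i :: 'n and x
  define f' where "f' i x = a / s x - 2 * a * (x $ i)\<^sup>2 / (s x)\<^sup>2 + \<beta>" for i :: 'n and x
  have fc: "continuous_on A (f i)" "continuous_on A (f' i)" for A i
    unfolding f_def f'_def by (intro continuous_intros sc; simp add: sne)+
  show ?thesis
  proof (rule weighted_hardy[OF \<phi> D, where f = f and f' = f'])
    show "f i \<in> borel_measurable borel" "f' i \<in> borel_measurable borel" for i
      by (intro borel_measurable_continuous_onI fc)+
  next
    fix i :: 'n and x :: "real^'n"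
    have q: "s (x + t *\<^sub>R axis i 1) = s x + 2 * t * (x $ i) + t\<^sup>2" for t
      unfolding s_def power2_norm_eq_inner
      by (simp add: inner_add_left inner_add_right inner_axis inner_axis' power2_eq_square distrib_left)
    have e: "f i (x + t *\<^sub>R axis i 1)
        = a * (x $ i + t) / (s x + 2 * t * (x $ i) + t\<^sup>2) + \<beta> * (x $ i + t)" for t
      unfolding f_def q by (simp add: axis_def)
    have "((\<lambda>t. a * (x $ i + t) / (s x + 2 * t * (x $ i) + t\<^sup>2) + \<beta> * (x $ i + t)) has_real_derivative
        (a * s x - a * (x $ i) * (2 * (x $ i))) / (s x * s x) + \<beta>) (at 0)"
      by (rule derivative_eq_intros refl | simp add: sne)+
    also have "(a * s x - a * (x $ i) * (2 * (x $ i))) / (s x * s x) + \<beta> = f' i x"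
      using sne[of x] by (simp add: f'_def diff_divide_distrib power2_eq_square)
    finally show "((\<lambda>t. f i (x + t *\<^sub>R axis i 1)) has_real_derivative f' i x) (at 0)"
      unfolding e .
  next
    fix i :: 'n and K :: "(real^'n) set" assume K: "compact K" "K \<subseteq> D"
    have "bounded (f i ` K)" "bounded (f' i ` K)"
      by (intro compact_imp_bounded compact_continuous_image K fc)+
    then obtain B1 B2 where "\<forall>x\<in>K. \<bar>f i x\<bar> \<le> B1" "\<forall>x\<in>K. \<bar>f' i x\<bar> \<le> B2"
      by (auto simp: bounded_iff)
    then show "\<exists>B. \<forall>x\<in>K. \<bar>f i x\<bar> \<le> B \<and> \<bar>f' i x\<bar> \<le> B"
      by (intro exI[of _ "max B1 B2"]) auto
  next
    fix x assume x: "x \<in> D"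
    have r: "(\<Sum>i\<in>UNIV. (x $ i)\<^sup>2) = (norm x)\<^sup>2"
      by (simp add: norm_vec_def L2_set_def sum_nonneg)
    have "f' i x - (f i x)\<^sup>2 = (a / s x + \<beta>) - (2 * a / (s x)\<^sup>2 + (a / s x + \<beta>)\<^sup>2) * (x $ i)\<^sup>2" for i
      using sne[of x] by (simp add: f_def f'_def field_simps power2_eq_square)
    then have "(\<Sum>i\<in>UNIV. f' i x - (f i x)\<^sup>2)
        = real CARD('n) * (a / s x + \<beta>) - (2 * a / (s x)\<^sup>2 + (a / s x + \<beta>)\<^sup>2) * (norm x)\<^sup>2"
      by (simp add: sum_subtractf r flip: sum_distrib_left)
    also have "\<dots> = real CARD('n) * (a / s x + \<beta>) - 2 * a * (norm x)\<^sup>2 / (s x)\<^sup>2 - (a / s x + \<beta>)\<^sup>2 * (norm x)\<^sup>2"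
      by (simp add: distrib_right)
    also have "\<dots> \<ge> a\<^sup>2 / s x + \<beta>"
      using \<epsilon> by (intro inverse_square_field_estimate a0 \<beta> x s0) (auto simp: a_def s_def field_simps)
    finally show "0 \<le> a\<^sup>2 / ((norm x)\<^sup>2 + \<epsilon>) + \<beta> \<and>
        a\<^sup>2 / ((norm x)\<^sup>2 + \<epsilon>) + \<beta> \<le> (\<Sum>i\<in>UNIV. f' i x - (f i x)\<^sup>2)"
      using s0[of x] \<beta> by (simp add: s_def)
  qed
qed

text \<open>Fatou's lemma along regularisations \<open>1 / (k + 1)\<close> tending to 0.\<close>

lemma improved_hardy:
  fixes D :: "(real^'n) set"
  defines "a \<equiv> (real CARD('n) - 2) / 2"
  assumes n: "CARD('n) \<ge> 2" and D: "open D" and \<beta>: "0 < \<beta>" "\<And>x. x \<in> D \<Longrightarrow> \<beta> * (norm x)\<^sup>2 \<le> 1"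
    and \<phi>: "\<phi> \<in> test_functions D"
  shows "(\<integral>\<^sup>+x. ennreal ((a\<^sup>2 / (norm x)\<^sup>2 + \<beta>) * (norm (\<phi> x))\<^sup>2) \<partial>lebesgue_on D)
    \<le> (\<integral>\<^sup>+x. ennreal ((norm (grad \<phi> x))\<^sup>2) \<partial>lebesgue_on D)"
proof -
  define h where "h k x = ennreal ((a\<^sup>2 / ((norm x)\<^sup>2 + inverse (real (Suc k))) + \<beta>) * (norm (\<phi> x))\<^sup>2)" for k x
  have [measurable]: "\<phi> \<in> borel_measurable (lebesgue_on D)"
    using test_function_continuous[OF \<phi>]
    by (intro measurable_restrict_space1 measurable_completion) (simp add: borel_measurable_continuous_onI)
  have [measurable]: "(\<lambda>x. norm x) \<in> borel_measurable (lebesgue_on D)"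
    by (intro measurable_restrict_space1 measurable_completion) simp
  have "(\<integral>\<^sup>+x. ennreal ((a\<^sup>2 / (norm x)\<^sup>2 + \<beta>) * (norm (\<phi> x))\<^sup>2) \<partial>lebesgue_on D)
      \<le> (\<integral>\<^sup>+x. liminf (\<lambda>k. h k x) \<partial>lebesgue_on D)"
  proof (rule nn_integral_mono)
    fix x
    show "ennreal ((a\<^sup>2 / (norm x)\<^sup>2 + \<beta>) * (norm (\<phi> x))\<^sup>2) \<le> liminf (\<lambda>k. h k x)"
    proof (cases "x = 0")
      \<comment> \<open>At the origin division by zero gives the singular term the value 0, so only
        \<open>\<beta>\<close> has to be dominated.\<close>
      case True
      then show ?thesis
        unfolding h_def
        by (intro Liminf_bounded always_eventually allI ennreal_leI mult_right_mono) auto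
    next
      case False
      have "(\<lambda>k. h k x) \<longlonglongrightarrow> ennreal ((a\<^sup>2 / ((norm x)\<^sup>2 + 0) + \<beta>) * (norm (\<phi> x))\<^sup>2)"
        unfolding h_def using False
        by (intro tendsto_ennrealI tendsto_intros LIMSEQ_inverse_real_of_nat) auto
      then show ?thesis by (simp add: lim_imp_Liminf)
    qed
  qed
  also have "\<dots> \<le> liminf (\<lambda>k. \<integral>\<^sup>+x. h k x \<partial>lebesgue_on D)"
    by (intro nn_integral_liminf) (unfold h_def, measurable)
  also have "\<dots> \<le> liminf (\<lambda>k::nat. \<integral>\<^sup>+x. ennreal ((norm (grad \<phi> x))\<^sup>2) \<partial>lebesgue_on D)"
    unfolding h_def a_def
    by (intro Liminf_mono always_eventually allI improved_hardy_regularized n D \<beta> \<phi>) auto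
  finally show ?thesis by (simp add: Liminf_const)
qed

section \<open>Exit times along lines\<close>

text \<open>For convex open bounded \<open>D\<close>, \<open>x\<close> in \<open>D\<close> and a
  unit vector \<open>e\<close>, this is the distance from \<open>x\<close> to the boundary in the
  direction \<open>e\<close>. In general it is the last exit of the line. Admitting negative
  \<open>t\<close> as well gives an exact shift rule in both directions.\<close>

definition exit_time :: "'a::real_vector set \<Rightarrow> 'a \<Rightarrow> 'a \<Rightarrow> real"
  where "exit_time D e x = Sup {t. x + t *\<^sub>R e \<in> D}"

context
  fixes D :: "'a::euclidean_space set" and e :: 'a and R :: real
  assumes bounded: "\<And>x. x \<in> D \<Longrightarrow> norm x \<le> R" and e: "norm e = 1"
begin

lemma exit_time_bound:
  assumes "x \<in> D" "x + t *\<^sub>R e \<in> D"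
  shows "t \<le> 2 * R"
proof -
  have "\<bar>t\<bar> = norm ((x + t *\<^sub>R e) - x)" using e by simp
  also have "\<dots> \<le> R + R"
    using bounded[OF assms(1)] bounded[OF assms(2)] norm_triangle_ineq4[of "x + t *\<^sub>R e" x] by linarith
  finally show ?thesis by simp
qed

lemma bdd_above_exit: "x \<in> D \<Longrightarrow> bdd_above {t. x + t *\<^sub>R e \<in> D}"
  using exit_time_bound by (intro bdd_aboveI[of _ "2 * R"]) auto

lemma exit_time_upper: "x \<in> D \<Longrightarrow> x + t *\<^sub>R e \<in> D \<Longrightarrow> t \<le> exit_time D e x"
  unfolding exit_time_def by (intro cSup_upper bdd_above_exit) auto

lemma exit_time_least:
  assumes "x \<in> D" "\<And>t. x + t *\<^sub>R e \<in> D \<Longrightarrow> t \<le> b"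
  shows "exit_time D e x \<le> b"
  unfolding exit_time_def using assms by (intro cSup_least) (auto intro!: exI[of _ 0])

lemma exit_time_le: "x \<in> D \<Longrightarrow> exit_time D e x \<le> 2 * R"
  using exit_time_least exit_time_bound by blast

text \<open>The exit time is affine with slope -1 along its own line. Hence its reciprocal is
  differentiable in that direction, with derivative its own square, whatever its behaviour across
  lines.\<close>

lemma exit_time_shift:
  assumes x: "x \<in> D" "x + s *\<^sub>R e \<in> D"
  shows "exit_time D e (x + s *\<^sub>R e) = exit_time D e x - s"
proof (rule antisym)
  show "exit_time D e (x + s *\<^sub>R e) \<le> exit_time D e x - s"
  proof (rule exit_time_least[OF x(2)])
    fix t assume "x + s *\<^sub>R e + t *\<^sub>R e \<in> D"
    then have "x + (s + t) *\<^sub>R e \<in> D" by (simp add: algebra_simps)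
    from exit_time_upper[OF x(1) this] show "t \<le> exit_time D e x - s" by simp
  qed
  have "exit_time D e x \<le> exit_time D e (x + s *\<^sub>R e) + s"
  proof (rule exit_time_least[OF x(1)])
    fix t assume "x + t *\<^sub>R e \<in> D"
    then have "(x + s *\<^sub>R e) + (t - s) *\<^sub>R e \<in> D" by (simp add: algebra_simps)
    from exit_time_upper[OF x(2) this] show "t \<le> exit_time D e (x + s *\<^sub>R e) + s" by simp
  qed
  then show "exit_time D e x - s \<le> exit_time D e (x + s *\<^sub>R e)" by simp
qed

text \<open>Keeps reciprocals of exit times bounded on compact subsets of \<open>D\<close>. The
  factor one half places the witness inside the open ball.\<close>

lemma exit_time_ge_ball:
  assumes "0 < r" "ball x r \<subseteq> D"
  shows "r / 2 \<le> exit_time D e x"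
proof (rule exit_time_upper)
  have "x \<in> ball x r" using assms(1) by simp
  then show "x \<in> D" using assms(2) by blast
  have "x + (r / 2) *\<^sub>R e \<in> ball x r" using assms(1) e by (simp add: dist_norm)
  then show "x + (r / 2) *\<^sub>R e \<in> D" using assms(2) by blast
qed

lemma exit_time_pos: "open D \<Longrightarrow> x \<in> D \<Longrightarrow> 0 < exit_time D e x"
  using exit_time_ge_ball unfolding open_contains_ball
  by (metis half_gt_zero less_le_trans)

text \<open>The exit time is lower semicontinuous on the open set \<open>D\<close>.\<close>

lemma exit_time_measurable:
  assumes D: "open D"
  shows "(\<lambda>x. if x \<in> D then exit_time D e x else 0) \<in> borel_measurable borel"
proof (subst borel_measurable_iff_greater, rule allI)
  fix a
  have "a < exit_time D e x \<longleftrightarrow> (\<exists>t>a. x + t *\<^sub>R e \<in> D)" if "x \<in> D" for x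
    unfolding exit_time_def using that
    by (subst less_cSup_iff) (auto intro: bdd_above_exit exI[of _ "0::real"])
  \<comment> \<open>The default value 0 off \<open>D\<close> puts the whole complement into the
    level set exactly when \<open>a < 0\<close>.\<close>
  then have "{x \<in> space borel. a < (if x \<in> D then exit_time D e x else 0)}
      = (D \<inter> (\<Union>t\<in>{a<..}. (\<lambda>x. x + t *\<^sub>R e) -` D)) \<union> (if a < 0 then - D else {})"
    by auto
  moreover have "open (D \<inter> (\<Union>t\<in>{a<..}. (\<lambda>x. x + t *\<^sub>R e) -` D))"
    using D by (intro open_Int open_UN ballI open_vimage continuous_intros)
  ultimately show "{x \<in> space borel. a < (if x \<in> D then exit_time D e x else 0)} \<in> sets borel"
    using D by auto
qed

end

text \<open>At the boundary point \<open>y\<close> nearest to \<open>x\<close>, the domain lies in a half-space with outer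
  normal \<open>\<nu>\<close>, and leaving the half-space takes time at most \<open>\<bar>x - y\<bar> / (\<nu> \<bullet> e)\<close>.\<close>

lemma exit_time_le_supporting_halfspace:
  fixes D :: "'a::euclidean_space set"
  assumes bd: "\<And>x. x \<in> D \<Longrightarrow> norm x \<le> R"
    and D: "open D" "convex D" and x: "x \<in> D" and y: "y \<in> frontier D"
  obtains \<nu> where "norm \<nu> = 1"
    "\<And>e. norm e = 1 \<Longrightarrow> inner \<nu> e / dist x y \<le> 1 / exit_time D e x"
proof -
  have yD: "y \<notin> D" using D(1) y by (simp add: frontier_def interior_open)
  \<comment> \<open>An open set misses its frontier, so \<open>D\<close> and \<open>{y}\<close> can
    be separated; the weak inequalities let the hyperplane be moved to pass through
    \<open>y\<close>.\<close>
  then obtain a b where ab: "a \<noteq> 0" "\<forall>z\<in>D. inner a z \<le> b" "b \<le> inner a y"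
    using separating_hyperplane_sets[of D "{y}"] D(2) x by auto
  define \<nu> where "\<nu> = a /\<^sub>R norm a"
  have \<nu>: "norm \<nu> = 1" using ab(1) by (simp add: \<nu>_def)
  have sup: "inner \<nu> z \<le> inner \<nu> y" if "z \<in> D" for z
  proof -
    have "inner a z \<le> inner a y" using ab that by force
    then show ?thesis using ab(1) by (simp add: \<nu>_def divide_right_mono)
  qed
  have d: "0 < dist x y" using yD x by auto
  have "inner \<nu> e / dist x y \<le> 1 / exit_time D e x" if e: "norm e = 1" for e
  proof (cases "0 < inner \<nu> e")
    case True
    have p: "0 < exit_time D e x" using exit_time_pos[OF bd e D(1) x] by simp
    have "exit_time D e x \<le> dist x y / inner \<nu> e"
    proof (rule exit_time_least[OF bd e x])
      fix t assume "x + t *\<^sub>R e \<in> D"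
      from sup[OF this] have "t * inner \<nu> e \<le> inner \<nu> (y - x)"
        by (simp add: inner_add_right inner_diff_right)
      also have "\<dots> \<le> norm \<nu> * norm (y - x)" by (rule norm_cauchy_schwarz)
      finally have "t * inner \<nu> e \<le> dist x y" using \<nu> by (simp add: dist_norm norm_minus_commute)
      then show "t \<le> dist x y / inner \<nu> e" using True by (simp add: field_simps)
    qed
    then show ?thesis using True p d by (simp add: field_simps)
  next
    case False
    moreover have "0 < exit_time D e x" using exit_time_pos[OF bd e D(1) x] by simp
    ultimately have "inner \<nu> e / dist x y \<le> 0" "0 \<le> 1 / exit_time D e x"
      using d by (simp_all add: divide_nonpos_pos)
    then show ?thesis by (rule order_trans)
  qed
  with \<nu> show thesis by (rule that)
qed

section \<open>The distance potential on a convex domain\<close>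

text \<open>Let \<open>A\<close> and \<open>B\<close> be the reciprocals of the exit times along the
  axis, forwards and backwards. Their derivatives are \<open>A\<^sup>2\<close> and
  \<open>- B\<^sup>2\<close>, so \<open>f = (A - B) / 2\<close> has
  \<open>f' - f\<^sup>2 = (A + B)\<^sup>2 / 4\<close>. One of the two squares dominates the squared
  component of the unit normal over the squared distance, and these sum to the Hardy weight; the
  other is at least \<open>1 / (2 * R)\<^sup>2\<close>, which gives the surplus.\<close>

lemma convex_improved_hardy:
  fixes D :: "(real^'n) set"
  assumes D: "open D" "convex D" "D \<noteq> {}" and R: "0 < R" "\<And>x. x \<in> D \<Longrightarrow> norm x \<le> R"
    and \<phi>: "\<phi> \<in> test_functions D"
  shows "(\<integral>\<^sup>+x. ennreal (((1 / 4) / (infdist x (frontier D))\<^sup>2 + 1 / (16 * R\<^sup>2)) * (norm (\<phi> x))\<^sup>2) \<partial>lebesgue_on D)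
    \<le> (\<integral>\<^sup>+x. ennreal ((norm (grad \<phi> x))\<^sup>2) \<partial>lebesgue_on D)"
proof -
  \<comment> \<open>The value 0 off \<open>D\<close> gives functions that are Borel on the whole
    space.\<close>
  define q where "q i x = (if x \<in> D then exit_time D (axis i 1) x else 0)" for i :: 'n and x :: "real^'n"
  define p where "p i x = (if x \<in> D then exit_time D (- axis i 1) x else 0)" for i :: 'n and x :: "real^'n"
  have n1: "norm (axis i 1 :: real^'n) = 1" "norm (- axis i 1 :: real^'n) = 1" for i
    by simp_all
  have [measurable]: "q i \<in> borel_measurable borel" "p i \<in> borel_measurable borel" for i
    unfolding q_def p_def using exit_time_measurable[OF R(2) _ D(1)] n1 by blast+
  have pos: "0 < q i x" "0 < p i x" "q i x \<le> 2 * R" "p i x \<le> 2 * R" if "x \<in> D" for i x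
    using that exit_time_pos[OF R(2) _ D(1)] exit_time_le[OF R(2)] n1 by (auto simp: q_def p_def)
  define f where "f i x = (1 / q i x - 1 / p i x) / 2" for i x
  define f' where "f' i x = (1 / (q i x)\<^sup>2 + 1 / (p i x)\<^sup>2) / 2" for i x
  show ?thesis
  proof (rule weighted_hardy[OF \<phi> D(1), where f = f and f' = f'])
    show "f i \<in> borel_measurable borel" "f' i \<in> borel_measurable borel" for i
      unfolding f_def f'_def by measurable
  next
    fix i :: 'n and x assume x: "x \<in> D"
    \<comment> \<open>The shift rule applies only while the point stays in \<open>D\<close>, that
      is, for \<open>t\<close> in this open neighbourhood of 0.\<close>
    let ?S = "(\<lambda>t. x + t *\<^sub>R axis i 1) -` D"
    have S: "open ?S" "0 \<in> ?S"
      using D(1) x by (auto intro!: open_vimage continuous_intros)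
    have sh: "q i (x + t *\<^sub>R axis i 1) = q i x - t" "p i (x + t *\<^sub>R axis i 1) = p i x + t"
      if "t \<in> ?S" for t
      using that x exit_time_shift[OF R(2) n1(1), where x = x and s = t]
        exit_time_shift[OF R(2) n1(2), where x = x and s = "- t"]
      by (auto simp: q_def p_def)
    have "((\<lambda>t. (1 / (q i x - t) - 1 / (p i x + t)) / 2) has_real_derivative f' i x) (at 0)"
      using pos[OF x, of i]
      by (auto intro!: derivative_eq_intros simp: f'_def power2_eq_square)
    then show "((\<lambda>t. f i (x + t *\<^sub>R axis i 1)) has_real_derivative f' i x) (at 0)"
      by (rule has_field_derivative_transform_within_open[OF _ S]) (simp add: f_def sh)
  next
    fix i :: 'n and K :: "(real^'n) set" assume K: "compact K" "K \<subseteq> D"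
    obtain r where r: "0 < r" "\<And>x. x \<in> K \<Longrightarrow> ball x r \<subseteq> D"
      using compact_subset_open_imp_ball_epsilon_subset[OF K(1) D(1) K(2)] by (metis UN_subset_iff)
    show "\<exists>B. \<forall>x\<in>K. \<bar>f i x\<bar> \<le> B \<and> \<bar>f' i x\<bar> \<le> B"
    proof (intro exI ballI)
      fix x assume xK: "x \<in> K"
      then have x: "x \<in> D" using K by auto
      have "r / 2 \<le> q i x" "r / 2 \<le> p i x"
        using exit_time_ge_ball[OF R(2) n1(1) r(1) r(2)[OF xK]]
          exit_time_ge_ball[OF R(2) n1(2) r(1) r(2)[OF xK]] x by (auto simp: q_def p_def)
      then have i: "0 < 1 / q i x" "0 < 1 / p i x" "1 / q i x \<le> 2 / r" "1 / p i x \<le> 2 / r"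
        using r(1) pos[OF x, of i] by (auto simp: field_simps)
      then have "(1 / q i x)\<^sup>2 \<le> (2 / r)\<^sup>2" "(1 / p i x)\<^sup>2 \<le> (2 / r)\<^sup>2"
        by (intro power_mono; simp)+
      then have "\<bar>f' i x\<bar> \<le> (2 / r)\<^sup>2" by (simp add: f'_def power_divide)
      moreover have "\<bar>f i x\<bar> \<le> 2 / r"
      proof -
        have "\<bar>A - B\<bar> \<le> 2 * C" if "0 < A" "0 < B" "A \<le> C" "B \<le> C" for A B C :: real
          using that by linarith
        from this[OF i] show ?thesis by (simp add: f_def)
      qed
      moreover have "0 \<le> 2 / r" "0 \<le> (2 / r)\<^sup>2" using r(1) by auto
      ultimately show "\<bar>f i x\<bar> \<le> 2 / r + (2 / r)\<^sup>2 \<and> \<bar>f' i x\<bar> \<le> 2 / r + (2 / r)\<^sup>2"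
        by linarith
    qed
  next
    fix x assume x: "x \<in> D"
    \<comment> \<open>This makes the frontier nonempty, so that the distance to it is
      attained.\<close>
    have "D \<noteq> UNIV"
      using R(2) not_bounded_UNIV[where 'a = "real^'n"] by (metis UNIV_I boundedI)
    then have "frontier D \<noteq> {}" using D(3) frontier_eq_empty by blast
    then obtain y where y: "y \<in> frontier D" "infdist x (frontier D) = dist x y"
      using infdist_attains_inf[of "frontier D" x] by auto
    obtain \<nu> where \<nu>: "norm \<nu> = 1"
      "\<And>e. norm e = 1 \<Longrightarrow> inner \<nu> e / dist x y \<le> 1 / exit_time D e x"
      using exit_time_le_supporting_halfspace[OF R(2) D(1,2) x y(1)] by blast
    have each: "(\<nu> $ i / dist x y)\<^sup>2 / 4 + 1 / (16 * R\<^sup>2) \<le> f' i x - (f i x)\<^sup>2" for i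
    proof -
      define A B N k where "A = 1 / q i x" and "B = 1 / p i x" and "N = \<nu> $ i / dist x y" and "k = 1 / (2 * R)"
      have "N \<le> A" "- N \<le> B"
        using \<nu>(2)[OF n1(1)[of i]] \<nu>(2)[OF n1(2)[of i]] x
        by (auto simp: A_def B_def N_def q_def p_def inner_axis)
      moreover have "k \<le> A" "k \<le> B" "0 \<le> k"
        using pos[OF x, of i] R(1) by (auto simp: A_def B_def k_def field_simps)
      ultimately have ABk: "N \<le> A" "- N \<le> B" "k \<le> A" "k \<le> B" "0 \<le> k" by auto
      have "N\<^sup>2 + k\<^sup>2 \<le> A\<^sup>2 + B\<^sup>2"
      \<comment> \<open>The sign of \<open>N\<close> decides whether \<open>A\<close> or
        \<open>B\<close> absorbs it; the remaining one absorbs \<open>k\<close>.\<close>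
      proof (cases "0 \<le> N")
        case True
        then show ?thesis using ABk by (intro add_mono power_mono) auto
      next
        case False
        then have "(- N)\<^sup>2 \<le> B\<^sup>2" "k\<^sup>2 \<le> A\<^sup>2" using ABk by (intro power_mono; simp)+
        then show ?thesis by simp
      qed
      also have "\<dots> \<le> (A + B)\<^sup>2"
        using ABk by (simp add: power2_sum)
      also have "(A + B)\<^sup>2 = 4 * (f' i x - (f i x)\<^sup>2)"
      proof -
        have eqs: "f' i x = (A\<^sup>2 + B\<^sup>2) / 2" "f i x = (A - B) / 2"
          by (simp_all add: A_def B_def f'_def f_def power_divide)
        show ?thesis unfolding eqs by (simp add: power2_eq_square field_simps)
      qed
      finally show ?thesis by (simp add: N_def k_def power_divide power_mult_distrib)
    qed
    \<comment> \<open>Every axis contributes a surplus, and one of these contributions is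
      enough.\<close>
    have "(1 / 4) / (infdist x (frontier D))\<^sup>2 + 1 / (16 * R\<^sup>2)
        \<le> (1 / 4) / (dist x y)\<^sup>2 + real CARD('n) * (1 / (16 * R\<^sup>2))"
    proof -
      have "1 \<le> real CARD('n)" by (simp add: Suc_leI)
      then have "1 * (1 / (16 * R\<^sup>2)) \<le> real CARD('n) * (1 / (16 * R\<^sup>2))"
        by (intro mult_right_mono) auto
      then show ?thesis by (simp add: y)
    qed
    also have "\<dots> = (\<Sum>i\<in>UNIV. (\<nu> $ i / dist x y)\<^sup>2 / 4 + 1 / (16 * R\<^sup>2))"
    proof -
      have "(\<Sum>i\<in>UNIV. (\<nu> $ i)\<^sup>2) = (norm \<nu>)\<^sup>2"
        by (simp add: norm_vec_def L2_set_def sum_nonneg)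
      then show ?thesis
        using \<nu>(1) by (simp add: sum.distrib power_divide flip: sum_divide_distrib)
    qed
    also have "\<dots> \<le> (\<Sum>i\<in>UNIV. f' i x - (f i x)\<^sup>2)" by (intro sum_mono each)
    finally show "0 \<le> (1 / 4) / (infdist x (frontier D))\<^sup>2 + 1 / (16 * R\<^sup>2) \<and>
        (1 / 4) / (infdist x (frontier D))\<^sup>2 + 1 / (16 * R\<^sup>2) \<le> (\<Sum>i\<in>UNIV. f' i x - (f i x)\<^sup>2)"
      by simp
  qed
qed

section \<open>Both cases of the bound on \<open>V\<close>\<close>

theorem theorem2p3:
  fixes D :: "(real^'n) set" and V :: "real^'n \<Rightarrow> real"
  assumes "CARD('n) \<ge> 2"
    and "domain D" and "bounded D"
    and "V \<in> borel_measurable (lebesgue_on D)"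
    and "(AE x in lebesgue_on D. \<bar>V x\<bar> \<le> ((real CARD('n) - 2) / 2)\<^sup>2 / (norm x)\<^sup>2)
       \<or> (convex D \<and> piecewise_smooth_boundary D \<and>
          (AE x in lebesgue_on D. \<bar>V x\<bar> \<le> (1 / 4) / (infdist x (frontier D))\<^sup>2))"
  shows "\<not> (\<exists>u\<in>W12_0 D. distributional_solution D V u \<and> \<not> (AE x in lebesgue_on D. u x = 0))"
proof -
  have D: "open D" "D \<noteq> {}" using assms(2) by (auto simp: domain_def)
  obtain R where R: "0 < R" "\<And>x. x \<in> D \<Longrightarrow> norm x \<le> R"
    using assms(3) bounded_pos by blast
  from assms(5) have "AE x in lebesgue_on D. u x = 0"
    if u: "u \<in> W12_0 D" "distributional_solution D V u" for u
  proof (elim disjE conjE)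
    assume V: "AE x in lebesgue_on D. \<bar>V x\<bar> \<le> ((real CARD('n) - 2) / 2)\<^sup>2 / (norm x)\<^sup>2"
    \<comment> \<open>As \<open>D\<close> lies in the ball of radius \<open>R\<close>, this is the
      largest constant that the bound \<open>R\<close> allows in the condition on
      \<open>\<beta>\<close>.\<close>
    have \<beta>: "0 < 1 / R\<^sup>2" "\<And>x. x \<in> D \<Longrightarrow> 1 / R\<^sup>2 * (norm x)\<^sup>2 \<le> 1"
      using R by (auto simp: power_mono)
    have m: "(\<lambda>x. ((real CARD('n) - 2) / 2)\<^sup>2 / (norm x)\<^sup>2) \<in> borel_measurable (lebesgue_on D)"
      by (intro measurable_restrict_space1 measurable_completion) simp
    show ?thesis
      using hardy_imp_no_solution[OF D(1) assms(4) m V _ \<beta>(1) improved_hardy[OF assms(1) D(1) \<beta>] u]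
      by simp
  next
    assume "convex D"
      and V: "AE x in lebesgue_on D. \<bar>V x\<bar> \<le> (1 / 4) / (infdist x (frontier D))\<^sup>2"
    have c: "0 < 1 / (16 * R\<^sup>2)" using R(1) by simp
    have m: "(\<lambda>x. (1 / 4) / (infdist x (frontier D))\<^sup>2) \<in> borel_measurable (lebesgue_on D)"
    proof (intro measurable_restrict_space1 measurable_completion)
      have [measurable]: "(\<lambda>x. infdist x (frontier D)) \<in> borel_measurable borel"
        by (intro borel_measurable_continuous_onI continuous_intros)
      show "(\<lambda>x. (1 / 4) / (infdist x (frontier D))\<^sup>2) \<in> borel_measurable lborel"
        by measurable
    qed
    show ?thesis
      using hardy_imp_no_solution[OF D(1) assms(4) m V _ c
          convex_improved_hardy[OF D(1) \<open>convex D\<close> D(2) R] u]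
      by simp
  qed
  then show ?thesis by blast
qed

end
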